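(* Let $n\ge2$, $s_1,s_2\in(0,1)$, $\sigma>0$, $\Omega:=B_1\subset\mathbb{R}^n$, $g:=0$, $K_1(\xi):=\frac{k_1}{|\xi|^{n+s_1}}$ and $K_2(\xi):=\frac{k_2}{|\xi|^{n+s_2}}$ for some $k_1,k_2>0$. Let $E$ be a volume-constrained minimizer of $\mathcal{C}$. Assume that there exist $p\in\partial B_1$ and $\varepsilon_0>0$ such that $B_{\varepsilon_0}(p)\cap B_1\subseteq E$. Assume also that $\mathrm{Reg}_E\cap\Omega\neq\varnothing$. Then either $s_1>s_2$, or $s_1=s_2$ and $k_1>\sigma k_2$.
   Context: $E^c:=\mathbb{R}^n\setminus E$; $I_i(E,F):=\int_E\int_FK_i(x-y)\,dx\,dy$ for disjoint measurable $E,F$. For $E\subseteq\Omega$, $\mathcal{C}(E):=I_1(E,E^c\cap\Omega)+\sigma I_2(E,\Omega^c)+\int_Eg(x)\,dx$ (here $g=0$). A volume-constrained minimizer is a set $E\subseteq\Omega$ minimizing $\mathcal{C}$ among all measurable subsets of $\Omega$ with the same Lebesgue measure as $E$, that measure being in $(0,|\Omega|)$. $\mathrm{Reg}_E$ is the set of all $x_0\in\overline{\Omega\cap\partial E}$ for which there exist $\rho>0$ and $\alpha\in(s_1,1)$ such that $B_\rho(x_0)\cap\overline{\Omega\cap\partial E}$ is a manifold of class $C^{1,\alpha}$, possibly with boundary, and the boundary (if any) is contained in $\partial\Omega$. *)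

theory Defs
  imports "HOL-Analysis.Analysis"
begin

section \<open>The nonlocal capillarity functional\<close>

text \<open>The kernel \<open>k / |\<xi>|^(n+s)\<close>; its junk value at \<open>\<xi> = 0\<close> is irrelevant, since the
  kernel is only integrated over pairs of points from disjoint sets.\<close>

definition frac_kernel :: "real \<Rightarrow> real \<Rightarrow> 'a::euclidean_space \<Rightarrow> real" where
  "frac_kernel k s \<xi> = k / norm \<xi> powr (real DIM('a) + s)"

definition interaction ::
    "('a::euclidean_space \<Rightarrow> real) \<Rightarrow> 'a set \<Rightarrow> 'a set \<Rightarrow> ennreal" where
  "interaction K E F = (\<integral>\<^sup>+x\<in>E. (\<integral>\<^sup>+y\<in>F. ennreal (K (x - y)) \<partial>lebesgue) \<partial>lebesgue)"

text \<open>The interactions may be infinite, so the energy takes extended real values.\<close>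

definition capillarity_energy ::
    "('a::euclidean_space \<Rightarrow> real) \<Rightarrow> ('a \<Rightarrow> real) \<Rightarrow> real \<Rightarrow> ('a \<Rightarrow> real) \<Rightarrow> 'a set \<Rightarrow> 'a set \<Rightarrow> ereal"
  where
  "capillarity_energy K1 K2 \<sigma> g \<Omega> E =
     enn2ereal (interaction K1 E (- E \<inter> \<Omega>))
     + ereal \<sigma> * enn2ereal (interaction K2 E (- \<Omega>))
     + ereal (LINT x:E|lebesgue. g x)"

definition volume_constrained_minimizer ::
    "('a::euclidean_space \<Rightarrow> real) \<Rightarrow> ('a \<Rightarrow> real) \<Rightarrow> real \<Rightarrow> ('a \<Rightarrow> real) \<Rightarrow> 'a set \<Rightarrow> 'a set \<Rightarrow> bool"
  where
  "volume_constrained_minimizer K1 K2 \<sigma> g \<Omega> E \<longleftrightarrow>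
     E \<in> sets lebesgue \<and> E \<subseteq> \<Omega> \<and>
     0 < emeasure lebesgue E \<and> emeasure lebesgue E < emeasure lebesgue \<Omega> \<and>
     (\<forall>F. F \<in> sets lebesgue \<and> F \<subseteq> \<Omega> \<and> emeasure lebesgue F = emeasure lebesgue E \<longrightarrow>
        capillarity_energy K1 K2 \<sigma> g \<Omega> E \<le> capillarity_energy K1 K2 \<sigma> g \<Omega> F)"

section \<open>Embedded manifolds of class \<open>C\<^sup>1\<^sup>,\<^sup>\<alpha>\<close>, possibly with boundary\<close>

definition holder_C1_on ::
    "real \<Rightarrow> 'a::real_normed_vector set \<Rightarrow> ('a \<Rightarrow> 'b::real_normed_vector) \<Rightarrow> bool" where
  "holder_C1_on \<alpha> U f \<longleftrightarrow>
     (\<exists>(f' :: 'a \<Rightarrow> 'a \<Rightarrow>\<^sub>L 'b) L.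
        (\<forall>x\<in>U. (f has_derivative blinfun_apply (f' x)) (at x)) \<and>
        (\<forall>x\<in>U. \<forall>y\<in>U. norm (f' x - f' y) \<le> L * dist x y powr \<alpha>))"

definition holder_C1_diffeo ::
    "real \<Rightarrow> 'a::euclidean_space set \<Rightarrow> 'a set \<Rightarrow> ('a \<Rightarrow> 'a) \<Rightarrow> bool" where
  "holder_C1_diffeo \<alpha> U V \<phi> \<longleftrightarrow>
     open U \<and> open V \<and> holder_C1_on \<alpha> U \<phi> \<and>
     (\<exists>\<psi>. homeomorphism U V \<phi> \<psi> \<and> holder_C1_on \<alpha> V \<psi>)"

text \<open>Submanifolds are described by charts of the ambient space. Near an interior point the chart
  straightens \<open>M\<close> to a \<open>d\<close>-dimensional subspace, near a boundary point to a closed half of one,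
  the point itself being sent to the origin, which lies on the edge.\<close>

definition manifold_interior_point ::
    "real \<Rightarrow> nat \<Rightarrow> 'a::euclidean_space set \<Rightarrow> 'a \<Rightarrow> bool" where
  "manifold_interior_point \<alpha> d M x \<longleftrightarrow>
     x \<in> M \<and>
     (\<exists>U V \<phi> S. x \<in> U \<and> holder_C1_diffeo \<alpha> U V \<phi> \<and> \<phi> x = 0 \<and>
        subspace S \<and> dim S = d \<and> \<phi> ` (M \<inter> U) = S \<inter> V)"

definition manifold_boundary_point ::
    "real \<Rightarrow> nat \<Rightarrow> 'a::euclidean_space set \<Rightarrow> 'a \<Rightarrow> bool" where
  "manifold_boundary_point \<alpha> d M x \<longleftrightarrow>
     x \<in> M \<and>
     (\<exists>U V \<phi> S v. x \<in> U \<and> holder_C1_diffeo \<alpha> U V \<phi> \<and> \<phi> x = 0 \<and>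
        subspace S \<and> dim S = d \<and> v \<in> S \<and> v \<noteq> 0 \<and>
        \<phi> ` (M \<inter> U) = {y \<in> S. 0 \<le> v \<bullet> y} \<inter> V)"

definition holder_C1_manifold_with_boundary ::
    "real \<Rightarrow> nat \<Rightarrow> 'a::euclidean_space set \<Rightarrow> bool" where
  "holder_C1_manifold_with_boundary \<alpha> d M \<longleftrightarrow>
     (\<forall>x\<in>M. manifold_interior_point \<alpha> d M x \<or> manifold_boundary_point \<alpha> d M x)"

definition manifold_boundary :: "real \<Rightarrow> nat \<Rightarrow> 'a::euclidean_space set \<Rightarrow> 'a set" where
  "manifold_boundary \<alpha> d M = {x. manifold_boundary_point \<alpha> d M x}"

text \<open>The regular set: here the manifolds are hypersurfaces, i.e. of dimension \<open>n - 1\<close>, and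
  \<open>\<partial>E\<close> is the topological boundary of the set \<open>E\<close> itself (no null set is removed or added).\<close>

definition Reg :: "real \<Rightarrow> 'a::euclidean_space set \<Rightarrow> 'a set \<Rightarrow> 'a set" where
  "Reg s1 \<Omega> E =
     {x0 \<in> closure (\<Omega> \<inter> frontier E).
        \<exists>\<rho>>0. \<exists>\<alpha>. s1 < \<alpha> \<and> \<alpha> < 1 \<and>
          (let M = ball x0 \<rho> \<inter> closure (\<Omega> \<inter> frontier E); d = DIM('a) - 1
           in holder_C1_manifold_with_boundary \<alpha> d M \<and>
              manifold_boundary \<alpha> d M \<subseteq> frontier \<Omega>)}"

end

theory Submission
  imports Defs
begin

text \<open>
  Throughout, \<open>\<Omega>\<close> is the open unit ball, \<open>I\<^sub>s(X, Y)\<close> is the interaction of \<open>X\<close> and \<open>Y\<close> through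
  the kernel \<open>|x - y|^-(n+s)\<close>, and \<open>P\<^sub>s(E) = I\<^sub>s(E, -E)\<close> is the fractional perimeter. Up to a
  null set the minimizer may be taken Borel. Suppose that it fills \<open>\<Omega>\<close> near the boundary point
  \<open>p\<close> although the conclusion fails, so that \<open>s1 < s2\<close>, or \<open>s1 = s2\<close> and \<open>k1 \<le> \<sigma> k2\<close>.

  If \<open>s1 < s2\<close>, touching the wall at \<open>p\<close> is too expensive. Cut the ball \<open>D\<close> of radius \<open>r\<close> around
  \<open>p\<close> out of \<open>E\<close>, and restore the volume by adding a ball \<open>D'\<close> placed well inside \<open>\<Omega>\<close>, where \<open>E\<close>
  leaves room for it and whose radius is at most a constant times \<open>r\<close>. The new interfaces cost
  at most \<open>P\<^sub>s\<^sub>1(D) + P\<^sub>s\<^sub>1(D')\<close>, which is of order \<open>r^(n-s1)\<close>; the contact of \<open>D'\<close> with the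
  wall costs \<open>O(r^n)\<close>; and the contact energy of \<open>D \<inter> \<Omega>\<close> that is saved is at least of order
  \<open>r^(n-s2)\<close>. For small \<open>r\<close> the gain wins (\<open>frac_minimizer_surgery\<close>, \<open>frac_perimeter_ball_le\<close>,
  \<open>frac_interaction_sphere_cap_ge\<close>, \<open>frac_minimizer_not_containing_cap\<close>).

  If \<open>s1 = s2 = s\<close> and \<open>k1 \<le> \<sigma> k2\<close>, the energy equals \<open>k1 P\<^sub>s(E) + (\<sigma> k2 - k1) I\<^sub>s(E, -\<Omega>)\<close>, and
  two-point rearrangement is available: for a hyperplane, replace \<open>E\<close> by its polarization
  towards the side that contains the centre of \<open>\<Omega>\<close>. This keeps the volume and the inclusion in
  \<open>\<Omega>\<close>, does not increase either term, and strictly decreases \<open>P\<^sub>s\<close> unless \<open>E\<close> is, up to null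
  sets, ordered with respect to its mirror image (\<open>frac_minimizer_polarization\<close>). Applied to
  bisecting hyperplanes, minimality then forces the following: if \<open>E\<close> is of full measure in \<open>\<Omega>\<close>
  near a boundary point \<open>q\<close> and near \<open>y\<close>, then also near every point closer than \<open>y\<close> both to \<open>q\<close>
  and to the centre (\<open>full_at_bisector\<close>). Hence the set of boundary points near which \<open>E\<close> has
  full measure is open and closed in the sphere, which is connected as \<open>n \<ge> 2\<close>. Containing \<open>p\<close>,
  it is the whole sphere, and then \<open>E\<close> fills \<open>\<Omega>\<close>, against the volume constraint
  (\<open>frac_minimizer_not_full_at_sphere\<close>).
\<close>

section \<open>Fractional interactions\<close>

text \<open>
  The interaction for the normalized kernel with respect to the Borel-Lebesgue measure. There
  \<open>0 powr _ = 0\<close> makes the kernel vanish on the diagonal, which only matters for overlapping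
  sets and then only on a null set.
\<close>

definition frac_interaction :: "real \<Rightarrow> 'a::euclidean_space set \<Rightarrow> 'a set \<Rightarrow> ennreal" where
  "frac_interaction s X Y =
     (\<integral>\<^sup>+x\<in>X. (\<integral>\<^sup>+y\<in>Y. ennreal (norm (x - y) powr - (real DIM('a) + s)) \<partial>lborel) \<partial>lborel)"

lemma interaction_frac_kernel:
  fixes X Y :: "'a::euclidean_space set"
  assumes [measurable]: "X \<in> sets borel" "Y \<in> sets borel" and "0 \<le> k"
  shows "interaction (frac_kernel k s) X Y = ennreal k * frac_interaction s X Y"
proof -
  have K: "ennreal (frac_kernel k s \<xi>) = ennreal k * ennreal (norm \<xi> powr - (real DIM('a) + s))"
    for \<xi> :: 'a
    using \<open>0 \<le> k\<close> unfolding frac_kernel_def powr_minus divide_inverse by (simp add: ennreal_mult)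
  show ?thesis
    unfolding interaction_def frac_interaction_def nn_integral_completion K
    by (simp add: nn_integral_cmult nn_integral_multc mult.assoc)
qed

text \<open>
  Null sets are invisible to the interaction, so a Lebesgue measurable set may be traded for a
  Borel set, for which Tonelli on the product of the Borel-Lebesgue measures is available.
\<close>

lemma interaction_cong_AE:
  fixes X Y :: "'a::euclidean_space set"
  assumes "AE x in lborel. x \<in> X \<longleftrightarrow> x \<in> X'" "AE y in lborel. y \<in> Y \<longleftrightarrow> y \<in> Y'"
  shows "interaction K X Y = interaction K X' Y'"
proof -
  have "(\<integral>\<^sup>+y\<in>Y. ennreal (K (x - y)) \<partial>lborel) = (\<integral>\<^sup>+y\<in>Y'. ennreal (K (x - y)) \<partial>lborel)" for x
    using assms(2) by (intro nn_integral_cong_AE) (auto split: split_indicator elim: eventually_mono)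
  then show ?thesis
    unfolding interaction_def nn_integral_completion
    using assms(1) by (intro nn_integral_cong_AE) (auto split: split_indicator elim: eventually_mono)
qed

lemma frac_interaction_pair:
  fixes X Y :: "'a::euclidean_space set"
  assumes [measurable]: "X \<in> sets borel" "Y \<in> sets borel"
  shows "frac_interaction s X Y =
    (\<integral>\<^sup>+z. indicator X (fst z) * indicator Y (snd z) *
       ennreal (norm (fst z - snd z) powr - (real DIM('a) + s)) \<partial>(lborel \<Otimes>\<^sub>M lborel))"
  unfolding frac_interaction_def
  by (subst lborel.nn_integral_fst[symmetric])
     (auto simp: nn_integral_cmult mult_ac intro!: nn_integral_cong)

lemma frac_interaction_commute:
  fixes X Y :: "'a::euclidean_space set"
  assumes [measurable]: "X \<in> sets borel" "Y \<in> sets borel"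
  shows "frac_interaction s X Y = frac_interaction s Y X"
proof -
  have "frac_interaction s X Y = (\<integral>\<^sup>+x. \<integral>\<^sup>+y. indicator X x * indicator Y y *
       ennreal (norm (x - y) powr - (real DIM('a) + s)) \<partial>lborel \<partial>lborel)"
    unfolding frac_interaction_def
    by (auto simp: nn_integral_cmult mult_ac intro!: nn_integral_cong)
  also have "\<dots> = (\<integral>\<^sup>+y. \<integral>\<^sup>+x. indicator X x * indicator Y y *
       ennreal (norm (x - y) powr - (real DIM('a) + s)) \<partial>lborel \<partial>lborel)"
    by (rule lborel_pair.Fubini') simp
  also have "\<dots> = (\<integral>\<^sup>+y. \<integral>\<^sup>+x. indicator Y y * (indicator X x *
       ennreal (norm (y - x) powr - (real DIM('a) + s))) \<partial>lborel \<partial>lborel)"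
    by (simp add: mult_ac norm_minus_commute)
  also have "\<dots> = frac_interaction s Y X"
    unfolding frac_interaction_def
    by (intro nn_integral_cong) (subst nn_integral_cmult, simp, simp add: mult.commute)
  finally show ?thesis .
qed

lemma frac_interaction_mono:
  assumes "X \<subseteq> X'" "Y \<subseteq> Y'"
  shows "frac_interaction s X Y \<le> frac_interaction s X' Y'"
  unfolding frac_interaction_def
  using assms by (intro nn_integral_mono mult_mono) (auto split: split_indicator)

lemma frac_interaction_Un_left:
  fixes X Y :: "'a::euclidean_space set"
  assumes [measurable]: "X \<in> sets borel" "X' \<in> sets borel" "Y \<in> sets borel"
  shows "X \<inter> X' = {} \<Longrightarrow> frac_interaction s (X \<union> X') Y = frac_interaction s X Y + frac_interaction s X' Y"
    and "frac_interaction s (X \<union> X') Y \<le> frac_interaction s X Y + frac_interaction s X' Y"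
  unfolding frac_interaction_def
  by (auto simp: nn_integral_add[symmetric] intro!: nn_integral_cong nn_integral_mono
      split: split_indicator)

lemma frac_interaction_Un_right:
  fixes X Y :: "'a::euclidean_space set"
  assumes [measurable]: "X \<in> sets borel" "Y \<in> sets borel" "Y' \<in> sets borel"
  shows "Y \<inter> Y' = {} \<Longrightarrow> frac_interaction s X (Y \<union> Y') = frac_interaction s X Y + frac_interaction s X Y'"
    and "frac_interaction s X (Y \<union> Y') \<le> frac_interaction s X Y + frac_interaction s X Y'"
  using frac_interaction_Un_left[of Y Y' X s]
  by (simp_all only: frac_interaction_commute[OF assms(1)] assms sets.Un)

lemma nn_integral_powr_to_inf:
  assumes "0 < a" "0 < r"
  shows "(\<integral>\<^sup>+u. ennreal (u powr (- a - 1)) * indicator {r..} u \<partial>lborel) = ennreal (r powr - a / a)"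
proof -
  have "((\<lambda>u. u powr (- a - 1)) has_integral (r powr - a / a)) {r..}"
    using has_integral_powr_to_inf[of "- a - 1" r] assms by simp
  from nn_integral_has_integral_lebesgue'[OF _ this] show ?thesis
    by (simp add: nn_integral_completion)
qed

text \<open>
  Superposition of the indicators of the balls of radius \<open>u > r\<close>: it turns integrals of the
  singular kernel into volumes.
\<close>

lemma powr_layer_cake:
  assumes "0 < a" "0 < r"
  shows "ennreal (r powr - a) = ennreal a * (\<integral>\<^sup>+u. ennreal (u powr (- a - 1)) * indicator {r<..} u \<partial>lborel)"
proof -
  have "(\<integral>\<^sup>+u. ennreal (u powr (- a - 1)) * indicator {r<..} u \<partial>lborel) =
      (\<integral>\<^sup>+u. ennreal (u powr (- a - 1)) * indicator {r..} u \<partial>lborel)"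
    using AE_lborel_singleton[of r]
    by (intro nn_integral_cong_AE) (auto split: split_indicator elim: eventually_mono)
  then show ?thesis
    unfolding nn_integral_powr_to_inf[OF assms] using assms by (simp add: ennreal_mult'[symmetric])
qed

text \<open>
  By the layer cake formula and Tonelli the interaction is the integral over \<open>u\<close> of
  \<open>(n+s) u^(-n-s-1)\<close> times the measure of the pairs at distance less than \<open>u\<close>. The first member
  of such a pair lies in the part of \<open>X\<close> that is \<open>u\<close>-close to \<open>Y\<close>, the second one in a ball of
  volume \<open>\<omega> u^n\<close>. One bound thus serves both for touching sets, through thin boundary layers,
  and for sets at a positive distance.
\<close>

lemma frac_interaction_le_layers:
  fixes X Y :: "'a::euclidean_space set" and \<mu> :: "real \<Rightarrow> ennreal"
  assumes [measurable]: "X \<in> sets borel" "Y \<in> sets borel" "\<mu> \<in> borel_measurable borel" and "0 < s"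
    and \<mu>: "\<And>u. 0 < u \<Longrightarrow> emeasure lborel (X \<inter> (\<Union>y\<in>Y. ball y u)) \<le> \<mu> u"
  shows "frac_interaction s X Y \<le> ennreal ((real DIM('a) + s) * unit_ball_vol (real DIM('a))) *
    (\<integral>\<^sup>+u. ennreal (u powr (- s - 1)) * \<mu> u * indicator {0<..} u \<partial>lborel)"
proof -
  define n where "n = real DIM('a)"
  define N where "N = n + s"
  define \<omega> where "\<omega> = unit_ball_vol n"
  have "0 < N" "0 < \<omega>"
    using \<open>0 < s\<close> by (auto simp: N_def n_def \<omega>_def)
  have m: "(\<lambda>z::'a \<times> 'a. indicator X (fst z) :: ennreal) \<in> borel_measurable borel"
    "(\<lambda>z::'a \<times> 'a. indicator Y (snd z) :: ennreal) \<in> borel_measurable borel"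
    "(\<lambda>z::'a \<times> 'a. dist (fst z) (snd z)) \<in> borel_measurable borel"
    unfolding borel_prod[symmetric] by measurable
  note [measurable] = m m[THEN measurable_compose[OF measurable_snd]]
  define h :: "real \<Rightarrow> 'a \<times> 'a \<Rightarrow> ennreal" where
    "h u z = ennreal (u powr (- N - 1)) * (indicator X (fst z) * indicator Y (snd z) *
        indicator {0<..} (u - dist (fst z) (snd z)))" for u z
  have hm [measurable]: "case_prod h \<in> borel_measurable (borel \<Otimes>\<^sub>M borel)"
    unfolding h_def split_beta' by measurable
  have layer: "(\<integral>\<^sup>+z. h u z \<partial>lborel) \<le> ennreal (\<omega> * u powr (- s - 1)) * \<mu> u * indicator {0<..} u" for u
  proof (cases "0 < u")
    case False
    then have "h u z = 0" for z
      using zero_le_dist[of "fst z" "snd z"] by (auto simp: h_def simp del: zero_le_dist split: split_indicator)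
    then show ?thesis by simp
  next
    case True
    have [measurable]: "X \<inter> (\<Union>y\<in>Y. ball y u) \<in> sets borel"
      using assms(1) by (intro sets.Int[OF _ borel_open]) auto
    have ball: "(\<integral>\<^sup>+y. c * (a * indicator (ball x u) y) \<partial>lborel) = c * (a * ennreal (\<omega> * u powr n))"
      for c a and x :: 'a
      using True unfolding mult.assoc[symmetric]
      by (subst nn_integral_cmult_indicator) (auto simp: emeasure_ball \<omega>_def n_def powr_realpow)
    have "(\<integral>\<^sup>+z. h u z \<partial>lborel) = (\<integral>\<^sup>+x. \<integral>\<^sup>+y. h u (x, y) \<partial>lborel \<partial>lborel)"
      unfolding lborel_prod[symmetric] by (subst lborel.nn_integral_fst) (auto simp: lborel_prod)
    also have "\<dots> \<le> (\<integral>\<^sup>+x. \<integral>\<^sup>+y. ennreal (u powr (- N - 1)) *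
        (indicator (X \<inter> (\<Union>y\<in>Y. ball y u)) x * indicator (ball x u) y) \<partial>lborel \<partial>lborel)"
      by (intro nn_integral_mono) (auto simp: h_def dist_commute split: split_indicator)
    also have "\<dots> = (\<integral>\<^sup>+x. ennreal (u powr (- N - 1)) *
        (indicator (X \<inter> (\<Union>y\<in>Y. ball y u)) x * ennreal (\<omega> * u powr n)) \<partial>lborel)"
      by (simp only: ball)
    also have "\<dots> = (\<integral>\<^sup>+x. (ennreal (u powr (- N - 1)) * ennreal (\<omega> * u powr n)) *
        indicator (X \<inter> (\<Union>y\<in>Y. ball y u)) x \<partial>lborel)"
      by (simp only: mult_ac)
    also have "\<dots> = ennreal (u powr (- N - 1)) * ennreal (\<omega> * u powr n) * emeasure lborel (X \<inter> (\<Union>y\<in>Y. ball y u))"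
      by (rule nn_integral_cmult_indicator) simp
    also have "\<dots> = ennreal (u powr (- N - 1)) * (ennreal (\<omega> * u powr n) * emeasure lborel (X \<inter> (\<Union>y\<in>Y. ball y u)))"
      by (rule mult.assoc)
    also have "\<dots> \<le> ennreal (u powr (- N - 1)) * (ennreal (\<omega> * u powr n) * \<mu> u)"
      using \<mu>[OF True] by (intro mult_left_mono) auto
    also have "\<dots> = ennreal (\<omega> * u powr (- s - 1)) * \<mu> u"
    proof -
      have "u powr (- N - 1) * (\<omega> * u powr n) = \<omega> * u powr (- s - 1)"
        using True by (simp add: N_def powr_add[symmetric])
      then have "ennreal (u powr (- N - 1)) * ennreal (\<omega> * u powr n) = ennreal (\<omega> * u powr (- s - 1))"
        using \<open>0 < \<omega>\<close> by (subst ennreal_mult[symmetric]) auto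
      then show ?thesis
        by (simp add: mult.assoc[symmetric])
    qed
    finally show ?thesis using True by simp
  qed
  have "frac_interaction s X Y = (\<integral>\<^sup>+z. indicator X (fst z) * indicator Y (snd z) *
       ennreal (norm (fst z - snd z) powr - N) \<partial>lborel)"
    by (subst frac_interaction_pair) (auto simp: lborel_prod N_def n_def)
  also have "\<dots> \<le> (\<integral>\<^sup>+z. ennreal N * (\<integral>\<^sup>+u. h u z \<partial>lborel) \<partial>lborel)"
  proof (intro nn_integral_mono)
    fix z :: "'a \<times> 'a"
    define r where "r = dist (fst z) (snd z)"
    show "indicator X (fst z) * indicator Y (snd z) * ennreal (norm (fst z - snd z) powr - N)
        \<le> ennreal N * (\<integral>\<^sup>+u. h u z \<partial>lborel)"
    proof (cases "r > 0")
      case False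
      then show ?thesis by (simp add: r_def)
    next
      case True
      have "(\<integral>\<^sup>+u. h u z \<partial>lborel) = (\<integral>\<^sup>+u. indicator X (fst z) * indicator Y (snd z) *
          (ennreal (u powr (- N - 1)) * indicator {r<..} u) \<partial>lborel)"
        by (intro nn_integral_cong) (auto simp: h_def r_def split: split_indicator)
      also have "\<dots> = indicator X (fst z) * indicator Y (snd z) *
          (\<integral>\<^sup>+u. ennreal (u powr (- N - 1)) * indicator {r<..} u \<partial>lborel)"
        by (rule nn_integral_cmult) simp
      finally have "(\<integral>\<^sup>+u. h u z \<partial>lborel) = indicator X (fst z) * indicator Y (snd z) *
          (\<integral>\<^sup>+u. ennreal (u powr (- N - 1)) * indicator {r<..} u \<partial>lborel)" .
      then show ?thesis
        using powr_layer_cake[OF \<open>0 < N\<close> True]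
        by (simp add: r_def dist_norm mult_ac)
    qed
  qed
  also have "\<dots> = ennreal N * (\<integral>\<^sup>+u. \<integral>\<^sup>+z. h u z \<partial>lborel \<partial>lborel)"
    by (subst lborel_pair.Fubini') (auto intro!: nn_integral_cmult)
  also have "\<dots> \<le> ennreal N * (\<integral>\<^sup>+u. ennreal (\<omega> * u powr (- s - 1)) * \<mu> u * indicator {0<..} u \<partial>lborel)"
    by (intro mult_left_mono nn_integral_mono layer) auto
  also have "(\<integral>\<^sup>+u. ennreal (\<omega> * u powr (- s - 1)) * \<mu> u * indicator {0<..} u \<partial>lborel) =
      ennreal \<omega> * (\<integral>\<^sup>+u. ennreal (u powr (- s - 1)) * \<mu> u * indicator {0<..} u \<partial>lborel)"
    using \<open>0 < \<omega>\<close> by (subst nn_integral_cmult[symmetric]) (auto simp: ennreal_mult mult_ac)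
  finally show ?thesis
    using \<open>0 < N\<close> \<open>0 < \<omega>\<close> by (simp add: N_def \<omega>_def n_def ennreal_mult mult.assoc)
qed

section \<open>Upper bounds by layers; the fractional perimeter of balls\<close>

text \<open>
  For sets at distance at least \<open>d\<close> only the layers \<open>u \<ge> d\<close> are nonempty, so the interaction is
  controlled by the volume of one of the two sets.
\<close>

lemma frac_interaction_separated_le:
  fixes X Y :: "'a::euclidean_space set"
  assumes [measurable]: "X \<in> sets borel" "Y \<in> sets borel" and "0 < s" "0 < d"
    and sep: "\<And>x y. x \<in> X \<Longrightarrow> y \<in> Y \<Longrightarrow> d \<le> dist x y"
  shows "frac_interaction s X Y \<le>
    ennreal ((real DIM('a) + s) * unit_ball_vol (real DIM('a)) * (d powr - s / s)) * emeasure lborel X"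
proof -
  have "frac_interaction s X Y \<le> ennreal ((real DIM('a) + s) * unit_ball_vol (real DIM('a))) *
    (\<integral>\<^sup>+u. ennreal (u powr (- s - 1)) * (emeasure lborel X * indicator {d..} u) * indicator {0<..} u \<partial>lborel)"
  proof (rule frac_interaction_le_layers)
    fix u :: real
    have "X \<inter> (\<Union>y\<in>Y. ball y u) = {}" if "u < d"
      using sep that by (force simp: dist_commute)
    then show "emeasure lborel (X \<inter> (\<Union>y\<in>Y. ball y u)) \<le> emeasure lborel X * indicator {d..} u"
      by (cases "u < d") (auto intro: emeasure_mono)
  qed (use \<open>0 < s\<close> in auto)
  also have "(\<integral>\<^sup>+u. ennreal (u powr (- s - 1)) * (emeasure lborel X * indicator {d..} u) * indicator {0<..} u \<partial>lborel)
      = (\<integral>\<^sup>+u. emeasure lborel X * (ennreal (u powr (- s - 1)) * indicator {d..} u) \<partial>lborel)"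
    using \<open>0 < d\<close> by (intro nn_integral_cong) (auto simp: mult_ac split: split_indicator)
  also have "\<dots> = emeasure lborel X * ennreal (d powr - s / s)"
    by (subst nn_integral_cmult) (auto simp: nn_integral_powr_to_inf[OF assms(3,4)])
  finally show ?thesis
    using assms(3) by (subst ennreal_mult) (auto simp: mult_ac)
qed

lemma nn_integral_powr_min:
  assumes "0 < s" "s < 1" "0 < r"
  shows "(\<integral>\<^sup>+u. ennreal (u powr (- s - 1)) * ennreal (min u r) * indicator {0<..} u \<partial>lborel) \<le>
    ennreal (r powr (1 - s) / (s * (1 - s)))"
proof -
  have I: "((\<lambda>u. u powr - s) has_integral (r powr (1 - s) / (1 - s))) {0..r}"
    using has_integral_powr_from_0[of "- s" r] assms by simp
  have "(\<integral>\<^sup>+u. ennreal (u powr (- s - 1)) * ennreal (min u r) * indicator {0<..} u \<partial>lborel) \<le>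
      (\<integral>\<^sup>+u. ennreal (u powr - s) * indicator {0..r} u +
        ennreal r * (ennreal (u powr (- s - 1)) * indicator {r..} u) \<partial>lborel)"
  proof (intro nn_integral_mono)
    fix u :: real
    have "u powr (- s - 1) * u = u powr - s" if "0 < u"
      using that powr_add[of u "- s - 1" 1] by simp
    then show "ennreal (u powr (- s - 1)) * ennreal (min u r) * indicator {0<..} u \<le>
      ennreal (u powr - s) * indicator {0..r} u +
        ennreal r * (ennreal (u powr (- s - 1)) * indicator {r..} u)"
      using \<open>0 < r\<close> by (auto simp: ennreal_mult[symmetric] min_def mult.commute split: split_indicator)
  qed
  also have "\<dots> = ennreal (r powr (1 - s) / (1 - s)) + ennreal r * ennreal (r powr - s / s)"
    using nn_integral_powr_to_inf[OF assms(1,3)] nn_integral_has_integral_lebesgue'[OF _ I]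
    by (subst nn_integral_add) (auto simp: nn_integral_cmult)
  also have "\<dots> = ennreal (r powr (1 - s) / (1 - s) + r * (r powr - s / s))"
    using assms by (simp add: ennreal_mult[symmetric] ennreal_plus[symmetric] del: ennreal_plus)
  also have "r * (r powr - s / s) = r powr (1 - s) / s"
    using powr_add[of r "- s" 1] assms by (simp add: mult.commute)
  also have "r powr (1 - s) / (1 - s) + r powr (1 - s) / s = r powr (1 - s) / (s * (1 - s))"
    using assms by (simp add: field_simps)
  finally show ?thesis .
qed

text \<open>
  The points of a ball that are \<open>u\<close>-close to its complement lie outside the concentric ball of
  radius \<open>r - u\<close>; the Bernoulli inequality linearizes the difference of the volumes.
\<close>

lemma emeasure_ball_inner_layer_le:
  fixes c :: "'a::euclidean_space"
  assumes "0 < r" "0 < u"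
  shows "emeasure lborel (ball c r \<inter> (\<Union>y\<in>- ball c r. ball y u)) \<le>
    ennreal (unit_ball_vol (real DIM('a)) * real DIM('a) * r ^ (DIM('a) - 1)) * ennreal (min u r)"
proof -
  define n where "n = DIM('a)"
  define \<omega> where "\<omega> = unit_ball_vol (real n)"
  have "0 < \<omega>" "0 < n" by (auto simp: \<omega>_def n_def)
  define v where "v = min u r"
  have v: "0 < v" "v \<le> r" using assms by (auto simp: v_def)
  have pow: "r ^ n = r * r ^ (n - 1)"
    using \<open>0 < n\<close> by (simp add: power_eq_if)
  have "(r - v) ^ n = (1 + (- v / r)) ^ n * r ^ n"
    using \<open>0 < r\<close> by (simp add: power_mult_distrib[symmetric] field_simps)
  also have "\<dots> \<ge> (1 + real n * (- v / r)) * r ^ n"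
    using v \<open>0 < r\<close> by (intro mult_right_mono Bernoulli_inequality) (auto simp: field_simps)
  finally have "r ^ n - (r - v) ^ n \<le> real n * v / r * r ^ n"
    by (simp add: algebra_simps)
  also have "real n * v / r * r ^ n = real n * r ^ (n - 1) * v"
    using \<open>0 < r\<close> by (simp add: pow)
  finally have *: "r ^ n - (r - v) ^ n \<le> real n * r ^ (n - 1) * v" .
  have "ball c r \<inter> (\<Union>y\<in>- ball c r. ball y u) \<subseteq> ball c r - ball c (r - v)"
  proof safe
    fix x y assume "x \<in> ball c r" "x \<in> ball c (r - v)" "x \<in> ball y u" "y \<notin> ball c r"
    then show False
      using dist_triangle[of c y x] by (auto simp: v_def min_def dist_commute split: if_splits)
  qed
  then have "emeasure lborel (ball c r \<inter> (\<Union>y\<in>- ball c r. ball y u)) \<le> emeasure lborel (ball c r - ball c (r - v))"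
    by (rule emeasure_mono) simp
  also have "\<dots> = emeasure lborel (ball c r) - emeasure lborel (ball c (r - v))"
    using v by (intro emeasure_Diff subset_ball) (auto simp: emeasure_ball)
  also have "\<dots> = ennreal (\<omega> * (r ^ n - (r - v) ^ n))"
    using v \<open>0 < \<omega>\<close> by (simp add: emeasure_ball \<omega>_def n_def ennreal_minus[symmetric] right_diff_distrib)
  also have "\<dots> \<le> ennreal (\<omega> * (real n * r ^ (n - 1) * v))"
    using * \<open>0 < \<omega>\<close> by (intro ennreal_leI mult_left_mono) auto
  also have "\<dots> = ennreal (\<omega> * real n * r ^ (n - 1)) * ennreal v"
    using v \<open>0 < r\<close> \<open>0 < \<omega>\<close> by (simp add: ennreal_mult[symmetric] mult_ac)
  finally show ?thesis by (simp add: v_def \<omega>_def n_def)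
qed

text \<open>
  The exponent \<open>n - s\<close> is the scaling of the fractional perimeter. Its finiteness for \<open>s < 1\<close>
  comes from the layer of width \<open>u\<close> having volume of order \<open>u\<close>, which makes \<open>u^(-s-1) u\<close>
  integrable at \<open>0\<close>.
\<close>

lemma frac_perimeter_ball_le:
  fixes s :: real
  assumes "0 < s" "s < 1"
  obtains C where "0 < C" "\<And>(c::'a::euclidean_space) r. 0 < r \<Longrightarrow>
    frac_interaction s (ball c r) (- ball c r) \<le> ennreal (C * r powr (real DIM('a) - s))"
proof
  define n where "n = real DIM('a)"
  define \<omega> where "\<omega> = unit_ball_vol n"
  define C where "C = (n + s) * \<omega> * (\<omega> * n / (s * (1 - s)))"
  have "0 < n" "0 < \<omega>" by (auto simp: n_def \<omega>_def)
  then show "0 < C" using assms by (simp add: C_def)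
  fix c :: 'a and r :: real
  assume "0 < r"
  define b where "b = \<omega> * n * r ^ (DIM('a) - 1)"
  have "0 < b" using \<open>0 < n\<close> \<open>0 < \<omega>\<close> \<open>0 < r\<close> by (simp add: b_def)
  have "frac_interaction s (ball c r) (- ball c r) \<le> ennreal ((n + s) * \<omega>) *
    (\<integral>\<^sup>+u. ennreal (u powr (- s - 1)) * (ennreal b * ennreal (min u r)) * indicator {0<..} u \<partial>lborel)"
    unfolding n_def \<omega>_def b_def using \<open>0 < s\<close> emeasure_ball_inner_layer_le[OF \<open>0 < r\<close>]
    by (intro frac_interaction_le_layers) auto
  also have "(\<integral>\<^sup>+u. ennreal (u powr (- s - 1)) * (ennreal b * ennreal (min u r)) * indicator {0<..} u \<partial>lborel)
      = ennreal b * (\<integral>\<^sup>+u. ennreal (u powr (- s - 1)) * ennreal (min u r) * indicator {0<..} u \<partial>lborel)"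
    by (subst nn_integral_cmult[symmetric]) (auto simp: mult_ac)
  also have "\<dots> \<le> ennreal b * ennreal (r powr (1 - s) / (s * (1 - s)))"
    by (intro mult_left_mono nn_integral_powr_min assms \<open>0 < r\<close>) auto
  also have "\<dots> = ennreal (b * (r powr (1 - s) / (s * (1 - s))))"
    using \<open>0 < b\<close> assms by (intro ennreal_mult[symmetric]) auto
  finally have "frac_interaction s (ball c r) (- ball c r) \<le>
      ennreal ((n + s) * \<omega>) * ennreal (b * (r powr (1 - s) / (s * (1 - s))))"
    by (simp add: mult_left_mono)
  also have "\<dots> = ennreal ((n + s) * \<omega> * (b * (r powr (1 - s) / (s * (1 - s)))))"
    using \<open>0 < n\<close> \<open>0 < \<omega>\<close> \<open>0 < b\<close> assms by (intro ennreal_mult[symmetric]) auto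
  also have "r ^ (DIM('a) - 1) * r powr (1 - s) = r powr (n - s)"
    using \<open>0 < r\<close> by (simp add: n_def powr_realpow[symmetric] powr_add[symmetric] of_nat_diff Suc_leI)
  then have "(n + s) * \<omega> * (b * (r powr (1 - s) / (s * (1 - s)))) = C * r powr (n - s)"
    by (simp add: C_def b_def mult_ac)
  finally show "frac_interaction s (ball c r) (- ball c r) \<le> ennreal (C * r powr (real DIM('a) - s))"
    by (simp add: n_def)
qed

section \<open>Reflections\<close>

lemma nn_integral_lborel_shift:
  fixes f :: "'a::euclidean_space \<Rightarrow> ennreal"
  assumes [measurable]: "f \<in> borel_measurable borel"
  shows "(\<integral>\<^sup>+x. f (x + a) \<partial>lborel) = (\<integral>\<^sup>+x. f x \<partial>lborel)"
proof -
  have "(\<integral>\<^sup>+x. f x \<partial>lborel) = (\<integral>\<^sup>+x. f x \<partial>distr lborel borel ((+) a))"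
    by (simp add: lborel_distr_plus)
  then show ?thesis
    by (simp add: nn_integral_distr add.commute)
qed

lemma nn_integral_lborel_point_reflect:
  fixes f :: "'a::euclidean_space \<Rightarrow> ennreal"
  assumes [measurable]: "f \<in> borel_measurable borel"
  shows "(\<integral>\<^sup>+x. f (a - x) \<partial>lborel) = (\<integral>\<^sup>+x. f x \<partial>lborel)"
proof -
  have "(\<integral>\<^sup>+x. f x \<partial>lborel) =
      (\<integral>\<^sup>+x. f x \<partial>density (distr lborel borel (\<lambda>x. a + (- 1) *\<^sub>R x)) (\<lambda>_. ennreal (\<bar>- 1\<bar> ^ DIM('a))))"
    by (subst lborel_affine[of "- 1" a]) auto
  then show ?thesis
    by (simp add: nn_integral_distr nn_integral_density)
qed

text \<open>
  The argument is the uniqueness proof for Haar measures: for the translation invariant image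
  measure \<open>\<mu>\<close> of Lebesgue measure \<open>\<lambda>\<close>, Tonelli gives \<open>\<mu>(A) \<lambda>(B) = \<mu>(B) \<lambda>(A)\<close>. Take for \<open>B\<close> the
  unit ball, which is its own preimage.
\<close>

lemma lborel_distr_orthogonal_transformation:
  fixes f :: "'a::euclidean_space \<Rightarrow> 'a"
  assumes "orthogonal_transformation f"
  shows "distr lborel borel f = lborel"
proof (rule measure_eqI)
  fix A assume "A \<in> sets (distr lborel borel f)"
  then have [measurable]: "A \<in> sets borel" by simp
  have "linear f" using assms by (rule orthogonal_transformation_linear)
  have [measurable]: "f \<in> borel_measurable borel"
    using \<open>linear f\<close> by (intro borel_measurable_continuous_onI linear_continuous_on) (simp add: linear_conv_bounded_linear)
  obtain g where g: "\<And>y. f (g y) = y"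
    using orthogonal_transformation_surj[OF assms] by (metis surj_def)
  define B where "B = ball (0::'a) 1"
  have [measurable]: "B \<in> sets borel" by (simp add: B_def)
  have fB: "f -` B = B"
    using orthogonal_transformation_norm[OF assms] by (auto simp: B_def)
  have [measurable]: "f -` A \<in> sets borel"
    using measurable_sets[of f borel borel A] by simp
  have "(\<integral>\<^sup>+x. indicator A (f x) \<partial>lborel) = (\<integral>\<^sup>+x. indicator (f -` A) x \<partial>lborel)"
    by (intro nn_integral_cong) (auto split: split_indicator)
  then have eA: "emeasure lborel (f -` A) = (\<integral>\<^sup>+x. indicator A (f x) \<partial>lborel)"
    by simp
  have "emeasure lborel (f -` A) * emeasure lborel B =
      (\<integral>\<^sup>+x. indicator A (f x) * emeasure lborel B \<partial>lborel)"
    unfolding eA by (rule nn_integral_multc[symmetric]) simp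
  also have "\<dots> = (\<integral>\<^sup>+x. \<integral>\<^sup>+y. indicator A (f x) * indicator B (f x - y) \<partial>lborel \<partial>lborel)"
    using nn_integral_lborel_point_reflect[of "indicator B"]
    by (intro nn_integral_cong) (simp add: nn_integral_cmult)
  also have "\<dots> = (\<integral>\<^sup>+y. \<integral>\<^sup>+x. indicator A (f x) * indicator B (f x - y) \<partial>lborel \<partial>lborel)"
    by (rule lborel_pair.Fubini') simp
  also have "\<dots> = (\<integral>\<^sup>+y. \<integral>\<^sup>+x. indicator A (f x + y) * indicator B (f x) \<partial>lborel \<partial>lborel)"
  proof (rule nn_integral_cong)
    fix y
    have "(\<integral>\<^sup>+x. indicator A (f x) * indicator B (f x - y) \<partial>lborel) =
        ((\<integral>\<^sup>+x. indicator A (f (x + g y)) * indicator B (f (x + g y) - y) \<partial>lborel) :: ennreal)"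
      by (rule nn_integral_lborel_shift[symmetric]) simp
    then show "(\<integral>\<^sup>+x. indicator A (f x) * indicator B (f x - y) \<partial>lborel) =
        ((\<integral>\<^sup>+x. indicator A (f x + y) * indicator B (f x) \<partial>lborel) :: ennreal)"
      by (simp add: linear_add[OF \<open>linear f\<close>] g)
  qed
  also have "\<dots> = (\<integral>\<^sup>+x. \<integral>\<^sup>+y. indicator A (f x + y) * indicator B (f x) \<partial>lborel \<partial>lborel)"
    by (rule lborel_pair.Fubini') simp
  also have "\<dots> = (\<integral>\<^sup>+x. emeasure lborel A * indicator B (f x) \<partial>lborel)"
  proof (rule nn_integral_cong)
    fix x
    have "(\<integral>\<^sup>+y. indicator A (f x + y) \<partial>lborel) = emeasure lborel A"
      using nn_integral_lborel_shift[of "indicator A" "f x"] by (simp add: add.commute[of _ "f x"])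
    then show "(\<integral>\<^sup>+y. indicator A (f x + y) * indicator B (f x) \<partial>lborel) =
        emeasure lborel A * indicator B (f x)"
      by (simp add: nn_integral_multc)
  qed
  also have "\<dots> = emeasure lborel A * emeasure lborel B"
    using fB by (simp add: nn_integral_cmult vimage_def indicator_def set_eq_iff flip: nn_integral_indicator)
  finally have "emeasure lborel B * emeasure lborel (f -` A) = emeasure lborel B * emeasure lborel A"
    by (simp add: mult.commute)
  moreover have "unit_ball_vol (real DIM('a)) \<noteq> 0"
    by (metis less_irrefl of_nat_0_le_iff unit_ball_vol_pos)
  then have "emeasure lborel B \<noteq> 0" "emeasure lborel B \<noteq> \<infinity>"
    by (auto simp: B_def emeasure_ball)
  ultimately show "emeasure (distr lborel borel f) A = emeasure lborel A"
    by (simp add: emeasure_distr ennreal_mult_cancel_left)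
qed simp

text \<open>
  For a unit vector \<open>e\<close> this is the reflection in the hyperplane \<open>z \<bullet> e = t\<close>, and \<open>z \<bullet> e - t\<close> is
  the signed distance to it.
\<close>

definition reflection :: "'a::euclidean_space \<Rightarrow> real \<Rightarrow> 'a \<Rightarrow> 'a" where
  "reflection e t z = z - (2 * (z \<bullet> e - t)) *\<^sub>R e"

context
  fixes e :: "'a::euclidean_space" and t :: real
  assumes e: "norm e = 1"
begin

lemma inner_e_e: "e \<bullet> e = 1"
  using e by (simp add: norm_eq_1)

lemma reflection_inner: "reflection e t z \<bullet> e - t = - (z \<bullet> e - t)"
  by (simp add: reflection_def inner_diff_left inner_e_e)

lemma reflection_reflection [simp]: "reflection e t (reflection e t z) = z"
proof -
  have "reflection e t (reflection e t z) = reflection e t z - (2 * - (z \<bullet> e - t)) *\<^sub>R e"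
    by (simp only: reflection_def[of e t "reflection e t z"] reflection_inner)
  also have "\<dots> = reflection e t z + (2 * (z \<bullet> e - t)) *\<^sub>R e"
    by (simp only: mult_minus_right scaleR_minus_left diff_minus_eq_add)
  finally show ?thesis by (simp add: reflection_def)
qed

text \<open>
  This identity is the source of every comparison below: for two points on the same side of the
  hyperplane, reflecting one of them increases their distance.
\<close>

lemma norm_diff_reflection_sqr:
  "(norm (z - reflection e t w))\<^sup>2 = (norm (z - w))\<^sup>2 + 4 * (z \<bullet> e - t) * (w \<bullet> e - t)"
proof -
  have *: "(norm (v + a *\<^sub>R e))\<^sup>2 = (norm v)\<^sup>2 + 2 * a * (v \<bullet> e) + a\<^sup>2" for v a
    by (simp only: power2_norm_eq_inner)
       (simp add: inner_add_left inner_add_right inner_e_e inner_commute[of e v] distrib_left power2_eq_square)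
  have "z - reflection e t w = (z - w) + (2 * (w \<bullet> e - t)) *\<^sub>R e"
    by (simp add: reflection_def)
  then show ?thesis
    by (simp only: *) (simp add: inner_diff_left algebra_simps power2_eq_square)
qed

lemma norm_reflection_diff_reflection [simp]:
  "norm (reflection e t z - reflection e t w) = norm (z - w)"
proof -
  have "(norm (reflection e t z - reflection e t w))\<^sup>2 =
      (norm (w - reflection e t z))\<^sup>2 + 4 * (reflection e t z \<bullet> e - t) * (w \<bullet> e - t)"
    by (simp only: norm_diff_reflection_sqr[of "reflection e t z" w] norm_minus_commute[of w])
  also have "\<dots> = (norm (w - z))\<^sup>2 + 4 * (w \<bullet> e - t) * (z \<bullet> e - t) + 4 * - (z \<bullet> e - t) * (w \<bullet> e - t)"
    by (simp only: norm_diff_reflection_sqr[of w z] reflection_inner)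
  also have "\<dots> = (norm (w - z))\<^sup>2"
    by (simp only: mult_minus_left mult_minus_right mult.assoc mult.commute[of "w \<bullet> e - t"] add.assoc)
  also have "\<dots> = (norm (z - w))\<^sup>2"
    by (simp only: norm_minus_commute)
  finally have "(norm (reflection e t z - reflection e t w))\<^sup>2 = (norm (z - w))\<^sup>2" .
  then show ?thesis
    by (rule power2_eq_imp_eq[OF _ norm_ge_zero norm_ge_zero])
qed

lemma norm_reflection_diff: "norm (reflection e t z - w) = norm (z - reflection e t w)"
  using norm_reflection_diff_reflection[of z "reflection e t w"] by (simp only: reflection_reflection)

lemma lborel_distr_reflection: "distr lborel borel (reflection e t) = lborel"
proof -
  define L where "L z = z - (2 * (z \<bullet> e)) *\<^sub>R e" for z
  have "orthogonal_transformation L"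
    unfolding orthogonal_transformation_def
  proof (intro conjI allI)
    show "linear L"
      by (rule linearI) (simp_all add: L_def inner_add_left scaleR_add_left scaleR_diff_right distrib_left)
    show "L v \<bullet> L w = v \<bullet> w" for v w
      by (simp add: L_def inner_diff_left inner_diff_right inner_e_e inner_commute[of e v]
          inner_commute[of e w])
  qed
  then have L: "distr lborel borel L = lborel"
    by (rule lborel_distr_orthogonal_transformation)
  have [measurable]: "L \<in> borel_measurable lborel"
    unfolding L_def by measurable
  have "reflection e t = (+) ((2 * t) *\<^sub>R e) \<circ> L"
    by (simp add: fun_eq_iff reflection_def L_def right_diff_distrib scaleR_diff_left)
  then have "distr lborel borel (reflection e t) = distr (distr lborel borel L) borel ((+) ((2 * t) *\<^sub>R e))"
    by (simp add: distr_distr)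
  then show ?thesis
    by (simp only: L lborel_distr_plus)
qed

lemma reflection_measurable [measurable]: "reflection e t \<in> borel_measurable borel"
  unfolding reflection_def by measurable

lemma nn_integral_lborel_reflection:
  "f \<in> borel_measurable borel \<Longrightarrow> (\<integral>\<^sup>+x. f (reflection e t x) \<partial>lborel) = (\<integral>\<^sup>+x. f x \<partial>lborel)"
  by (subst (2) lborel_distr_reflection[symmetric]) (simp add: nn_integral_distr)

end

section \<open>Polarization decreases fractional interactions\<close>

text \<open>
  Two-point rearrangement: of each pair of mirror images of which exactly one belongs to \<open>E\<close>,
  the one in the half-space \<open>z \<bullet> e < t\<close> is kept.
\<close>

definition polarization :: "'a::euclidean_space \<Rightarrow> real \<Rightarrow> 'a set \<Rightarrow> 'a set" where
  "polarization e t E = {z. if z \<bullet> e < t then z \<in> E \<or> reflection e t z \<in> E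
     else z \<in> E \<and> reflection e t z \<in> E}"

text \<open>
  The integrand of the interaction of \<open>E\<close> with the complement of \<open>G\<close>, summed over the four pairs
  obtained from \<open>(x, y)\<close> by reflecting either point. Polarization permutes the indicators within
  such a quadruple, so the effect on the interaction can be read off pointwise.
\<close>

definition four_point_sum ::
    "real \<Rightarrow> 'a::euclidean_space \<Rightarrow> real \<Rightarrow> 'a set \<Rightarrow> 'a set \<Rightarrow> 'a \<Rightarrow> 'a \<Rightarrow> ennreal" where
  "four_point_sum s e t E G x y =
     ennreal (norm (x - y) powr - (real DIM('a) + s)) *
       (indicator E x * indicator (- G) y +
        indicator E (reflection e t x) * indicator (- G) (reflection e t y)) +
     ennreal (norm (x - reflection e t y) powr - (real DIM('a) + s)) *
       (indicator E x * indicator (- G) (reflection e t y) +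
        indicator E (reflection e t x) * indicator (- G) y)"

context
  fixes e :: "'a::euclidean_space" and t :: real
  assumes e: "norm e = 1"
begin

declare reflection_measurable[OF e, measurable]

lemma nn_integral_pair_reflection:
  fixes f :: "'a \<times> 'a \<Rightarrow> ennreal"
  assumes [measurable]: "f \<in> borel_measurable (borel \<Otimes>\<^sub>M borel)"
  shows "(\<integral>\<^sup>+p. f (reflection e t (fst p), snd p) \<partial>(lborel \<Otimes>\<^sub>M lborel)) = (\<integral>\<^sup>+p. f p \<partial>(lborel \<Otimes>\<^sub>M lborel))"
    and "(\<integral>\<^sup>+p. f (fst p, reflection e t (snd p)) \<partial>(lborel \<Otimes>\<^sub>M lborel)) = (\<integral>\<^sup>+p. f p \<partial>(lborel \<Otimes>\<^sub>M lborel))"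
  using nn_integral_lborel_reflection[OF e, of "\<lambda>x. \<integral>\<^sup>+y. f (x, y) \<partial>lborel" t]
    nn_integral_lborel_reflection[OF e, of "\<lambda>y. f (x, y)" t for x]
  by (simp_all add: lborel.nn_integral_fst[symmetric])

lemma four_point_sum_integral:
  assumes [measurable]: "E \<in> sets borel" "G \<in> sets borel"
  shows "4 * frac_interaction s E (- G) =
    (\<integral>\<^sup>+p. four_point_sum s e t E G (fst p) (snd p) \<partial>(lborel \<Otimes>\<^sub>M lborel))"
proof -
  define h :: "'a \<times> 'a \<Rightarrow> ennreal" where
    "h p = indicator E (fst p) * indicator (- G) (snd p) *
       ennreal (norm (fst p - snd p) powr - (real DIM('a) + s))" for p
  have [measurable]: "h \<in> borel_measurable (borel \<Otimes>\<^sub>M borel)"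
    unfolding h_def by measurable
  have h: "frac_interaction s E (- G) = (\<integral>\<^sup>+p. h p \<partial>(lborel \<Otimes>\<^sub>M lborel))"
    unfolding h_def by (rule frac_interaction_pair) auto
  let ?R = "reflection e t"
  have 1: "(\<integral>\<^sup>+p. h (?R (fst p), snd p) \<partial>(lborel \<Otimes>\<^sub>M lborel)) = frac_interaction s E (- G)"
    unfolding h by (rule nn_integral_pair_reflection) simp
  have 2: "(\<integral>\<^sup>+p. h (fst p, ?R (snd p)) \<partial>(lborel \<Otimes>\<^sub>M lborel)) = frac_interaction s E (- G)"
    unfolding h by (rule nn_integral_pair_reflection) simp
  have 3: "(\<integral>\<^sup>+p. h (?R (fst p), ?R (snd p)) \<partial>(lborel \<Otimes>\<^sub>M lborel)) = frac_interaction s E (- G)"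
    using nn_integral_pair_reflection(1)[of "\<lambda>p. h (fst p, ?R (snd p))"] 2 by simp
  have "(\<integral>\<^sup>+p. four_point_sum s e t E G (fst p) (snd p) \<partial>(lborel \<Otimes>\<^sub>M lborel)) =
      (\<integral>\<^sup>+p. (h p + h (?R (fst p), snd p)) + (h (fst p, ?R (snd p)) + h (?R (fst p), ?R (snd p)))
        \<partial>(lborel \<Otimes>\<^sub>M lborel))"
    by (intro nn_integral_cong)
       (simp add: four_point_sum_def h_def norm_reflection_diff_reflection[OF e] norm_reflection_diff[OF e]
         reflection_reflection[OF e] distrib_left mult_ac add_ac)
  also have "\<dots> = (frac_interaction s E (- G) + frac_interaction s E (- G)) +
      (frac_interaction s E (- G) + frac_interaction s E (- G))"
    by (simp add: nn_integral_add 1 2 3 h[symmetric])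
  also have "\<dots> = 4 * frac_interaction s E (- G)"
    by (simp add: mult_2[symmetric] mult.assoc[symmetric])
  finally show ?thesis ..
qed

text \<open>
  Points on the hyperplane are fixed by the reflection, so there both clauses of the definition
  agree. Hence the side of \<open>x\<close> alone also decides about the mirror image of \<open>x\<close>.
\<close>

lemma mem_polarization:
  "x \<in> polarization e t E \<longleftrightarrow>
     (if x \<bullet> e < t then x \<in> E \<or> reflection e t x \<in> E else x \<in> E \<and> reflection e t x \<in> E)"
  "reflection e t x \<in> polarization e t E \<longleftrightarrow>
     (if x \<bullet> e < t then x \<in> E \<and> reflection e t x \<in> E else x \<in> E \<or> reflection e t x \<in> E)"
proof -
  show "x \<in> polarization e t E \<longleftrightarrow>
     (if x \<bullet> e < t then x \<in> E \<or> reflection e t x \<in> E else x \<in> E \<and> reflection e t x \<in> E)"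
    by (simp add: polarization_def)
  have "reflection e t x = x" if "x \<bullet> e = t"
    using that by (simp add: reflection_def)
  then show "reflection e t x \<in> polarization e t E \<longleftrightarrow>
     (if x \<bullet> e < t then x \<in> E \<and> reflection e t x \<in> E else x \<in> E \<or> reflection e t x \<in> E)"
    using reflection_inner[OF e, of t x]
    by (cases "x \<bullet> e" t rule: linorder_cases)
       (auto simp: polarization_def reflection_reflection[OF e])
qed

lemma polarization_measurable [measurable]:
  assumes [measurable]: "E \<in> sets borel"
  shows "polarization e t E \<in> sets borel"
  unfolding polarization_def by measurable

lemma emeasure_polarization:
  assumes [measurable]: "E \<in> sets borel"
  shows "emeasure lborel (polarization e t E) = emeasure lborel E"
proof -
  have double: "2 * emeasure lborel A = (\<integral>\<^sup>+x. indicator A x + indicator A (reflection e t x) \<partial>lborel)"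
    if [measurable]: "A \<in> sets borel" for A
    using nn_integral_lborel_reflection[OF e, of "indicator A" t]
    by (simp add: nn_integral_add mult_2)
  have "2 * emeasure lborel (polarization e t E) = 2 * emeasure lborel E"
    unfolding double[OF assms] double[OF polarization_measurable[OF assms]]
  proof (rule nn_integral_cong)
    fix x
    show "indicator (polarization e t E) x + indicator (polarization e t E) (reflection e t x) =
        (indicator E x + indicator E (reflection e t x) :: ennreal)"
      by (auto simp: indicator_def mem_polarization(1)[of x] mem_polarization(2)[of x])
  qed
  then show ?thesis
    by (simp add: ennreal_mult_cancel_left)
qed

lemma kernel_reflection_mono:
  fixes s :: real
  assumes "0 < s"
  shows "0 \<le> (x \<bullet> e - t) * (y \<bullet> e - t) \<Longrightarrow> x \<noteq> y \<Longrightarrow>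
      norm (x - reflection e t y) powr - (real DIM('a) + s) \<le> norm (x - y) powr - (real DIM('a) + s)"
    and "(x \<bullet> e - t) * (y \<bullet> e - t) \<le> 0 \<Longrightarrow> x \<noteq> reflection e t y \<Longrightarrow>
      norm (x - y) powr - (real DIM('a) + s) \<le> norm (x - reflection e t y) powr - (real DIM('a) + s)"
    and "0 < (x \<bullet> e - t) * (y \<bullet> e - t) \<Longrightarrow> x \<noteq> y \<Longrightarrow>
      norm (x - reflection e t y) powr - (real DIM('a) + s) < norm (x - y) powr - (real DIM('a) + s)"
proof -
  have sq: "(norm (x - reflection e t y))\<^sup>2 = (norm (x - y))\<^sup>2 + 4 * ((x \<bullet> e - t) * (y \<bullet> e - t))"
    using norm_diff_reflection_sqr[OF e, of x t y] by simp
  show "norm (x - reflection e t y) powr - (real DIM('a) + s) \<le> norm (x - y) powr - (real DIM('a) + s)"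
    if "0 \<le> (x \<bullet> e - t) * (y \<bullet> e - t)" "x \<noteq> y"
    using that sq \<open>0 < s\<close> by (intro powr_mono2' power2_le_imp_le[of "norm (x - y)"]) auto
  show "norm (x - y) powr - (real DIM('a) + s) \<le> norm (x - reflection e t y) powr - (real DIM('a) + s)"
    if "(x \<bullet> e - t) * (y \<bullet> e - t) \<le> 0" "x \<noteq> reflection e t y"
    using that sq \<open>0 < s\<close> by (intro powr_mono2' power2_le_imp_le[of "norm (x - reflection e t y)"]) auto
  show "norm (x - reflection e t y) powr - (real DIM('a) + s) < norm (x - y) powr - (real DIM('a) + s)"
    if "0 < (x \<bullet> e - t) * (y \<bullet> e - t)" "x \<noteq> y"
    using that sq \<open>0 < s\<close> by (intro powr_less_mono2_neg power2_less_imp_less[of "norm (x - y)"]) auto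
qed

text \<open>
  For \<open>x\<close> and \<open>y\<close> on the same side, polarization shifts weight from the pair kernel \<open>a\<close> to the
  smaller kernel \<open>b\<close>; on opposite sides it is the other way around. The hypothesis \<open>E \<subseteq> G\<close> is
  what handles \<open>x = y\<close> and \<open>x = R y\<close>: there the kernel degenerates to \<open>0\<close>, but its weight
  vanishes as well.
\<close>

lemma four_point_sum_polarization_le:
  assumes "0 < s" "E \<subseteq> G"
  shows "four_point_sum s e t (polarization e t E) (polarization e t G) x y \<le> four_point_sum s e t E G x y"
proof -
  let ?R = "reflection e t"
  define a where "a = ennreal (norm (x - y) powr - (real DIM('a) + s))"
  define b where "b = ennreal (norm (x - ?R y) powr - (real DIM('a) + s))"
  note mem = mem_polarization(1)[of x] mem_polarization(2)[of x] mem_polarization(1)[of y] mem_polarization(2)[of y]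
  note S = four_point_sum_def a_def[symmetric] b_def[symmetric]
  consider "x = y" | "x = ?R y" "x \<noteq> y" | "x \<noteq> y" "x \<noteq> ?R y" "x \<bullet> e < t \<longleftrightarrow> y \<bullet> e < t"
    | "x \<noteq> y" "x \<noteq> ?R y" "x \<bullet> e < t \<longleftrightarrow> \<not> y \<bullet> e < t"
    by blast
  then show ?thesis
  proof cases
    case 1
    then show ?thesis
      using \<open>E \<subseteq> G\<close> unfolding S by (auto simp: indicator_def mem)
  next
    case 2
    then show ?thesis
      using \<open>E \<subseteq> G\<close> reflection_reflection[OF e, of t y] unfolding S
      by (auto simp: indicator_def mem)
  next
    case 3
    then have "0 \<le> (x \<bullet> e - t) * (y \<bullet> e - t)"
      by (auto simp: zero_le_mult_iff)
    then have "b \<le> a"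
      unfolding a_def b_def using kernel_reflection_mono(1)[OF \<open>0 < s\<close>] 3 by (auto intro: ennreal_leI)
    then show ?thesis
      using 3(3) unfolding S by (auto simp: indicator_def mem add.commute)
  next
    case 4
    then have "(x \<bullet> e - t) * (y \<bullet> e - t) \<le> 0"
      by (auto simp: mult_le_0_iff)
    then have "a \<le> b"
      unfolding a_def b_def using kernel_reflection_mono(2)[OF \<open>0 < s\<close>] 4 by (auto intro: ennreal_leI)
    then show ?thesis
      using 4(3) unfolding S by (auto simp: indicator_def mem add.commute)
  qed
qed

lemma four_point_sum_polarization_less:
  assumes "0 < s" "x \<bullet> e < t" "y \<bullet> e < t"
    and "x \<in> E" "reflection e t x \<notin> E" "y \<notin> E" "reflection e t y \<in> E"
  shows "four_point_sum s e t (polarization e t E) (polarization e t E) x y < four_point_sum s e t E E x y"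
proof -
  have "0 < (x \<bullet> e - t) * (y \<bullet> e - t)" "x \<noteq> y"
    using assms by (auto simp: zero_less_mult_iff)
  then have "ennreal (norm (x - reflection e t y) powr - (real DIM('a) + s)) <
      ennreal (norm (x - y) powr - (real DIM('a) + s))"
    using kernel_reflection_mono(3)[OF \<open>0 < s\<close>] by (simp add: ennreal_less_iff)
  then show ?thesis
    using assms(2-) unfolding four_point_sum_def
    by (simp add: indicator_def mem_polarization(1)[of x] mem_polarization(2)[of x]
        mem_polarization(1)[of y] mem_polarization(2)[of y])
qed

lemma frac_interaction_polarization_le:
  assumes [measurable]: "E \<in> sets borel" "G \<in> sets borel" and "0 < s" "E \<subseteq> G"
  shows "frac_interaction s (polarization e t E) (- polarization e t G) \<le> frac_interaction s E (- G)"
proof -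
  have "4 * frac_interaction s (polarization e t E) (- polarization e t G) \<le> 4 * frac_interaction s E (- G)"
    unfolding four_point_sum_integral[OF assms(1,2)]
      four_point_sum_integral[OF assms(1,2)[THEN polarization_measurable]]
    by (intro nn_integral_mono four_point_sum_polarization_le assms(3,4))
  then show ?thesis
    by (subst (asm) ennreal_mult_le_mult_iff) auto
qed

text \<open>
  A strict gain occurs at each pair \<open>(x, y)\<close> with \<open>x\<close> in the first and \<open>y\<close> in the second of the
  two sets: exchanging \<open>y\<close> with its mirror image moves the complement of \<open>E\<close> away from \<open>x\<close>.
\<close>

lemma frac_interaction_polarization_less:
  assumes [measurable]: "E \<in> sets borel" and "0 < s"
    and fin: "frac_interaction s E (- E) < \<infinity>"
    and A: "0 < emeasure lborel {x \<in> E. x \<bullet> e < t \<and> reflection e t x \<notin> E}"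
    and B: "0 < emeasure lborel {x \<in> - E. x \<bullet> e < t \<and> reflection e t x \<in> E}"
  shows "frac_interaction s (polarization e t E) (- polarization e t E) < frac_interaction s E (- E)"
proof -
  define A where "A = {x \<in> E. x \<bullet> e < t \<and> reflection e t x \<notin> E}"
  define B where "B = {x \<in> - E. x \<bullet> e < t \<and> reflection e t x \<in> E}"
  have [measurable]: "A \<in> sets borel" "B \<in> sets borel"
    unfolding A_def B_def by measurable
  let ?S = "\<lambda>F p. four_point_sum s e t F F (fst p) (snd p)"
  have m [measurable]: "?S F \<in> borel_measurable (lborel \<Otimes>\<^sub>M lborel)" if [measurable]: "F \<in> sets borel" for F
    unfolding four_point_sum_def by measurable
  have "(\<integral>\<^sup>+p. ?S (polarization e t E) p \<partial>(lborel \<Otimes>\<^sub>M lborel)) < (\<integral>\<^sup>+p. ?S E p \<partial>(lborel \<Otimes>\<^sub>M lborel))"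
  proof (rule nn_integral_less)
    have "4 * frac_interaction s (polarization e t E) (- polarization e t E) \<le> 4 * frac_interaction s E (- E)"
      using assms by (intro mult_left_mono frac_interaction_polarization_le) auto
    also have "\<dots> < \<infinity>"
      using fin by (simp add: ennreal_mult_less_top)
    finally show "(\<integral>\<^sup>+p. ?S (polarization e t E) p \<partial>(lborel \<Otimes>\<^sub>M lborel)) \<noteq> \<infinity>"
      by (simp add: four_point_sum_integral)
    show "AE p in lborel \<Otimes>\<^sub>M lborel. ?S (polarization e t E) p \<le> ?S E p"
      by (intro AE_I2 four_point_sum_polarization_le \<open>0 < s\<close> order_refl)
    show "\<not> (AE p in lborel \<Otimes>\<^sub>M lborel. ?S E p \<le> ?S (polarization e t E) p)"
    proof
      assume "AE p in lborel \<Otimes>\<^sub>M lborel. ?S E p \<le> ?S (polarization e t E) p"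
      then have "AE p in lborel \<Otimes>\<^sub>M lborel. p \<notin> A \<times> B"
        by (rule eventually_mono)
           (use four_point_sum_polarization_less[OF \<open>0 < s\<close>] in \<open>fastforce simp: A_def B_def not_le[symmetric]\<close>)
      then have "emeasure (lborel \<Otimes>\<^sub>M lborel) (A \<times> B) = 0"
        by (subst (asm) AE_iff_measurable[of "A \<times> B"]) (auto simp: space_pair_measure)
      then show False
        using A B unfolding A_def[symmetric] B_def[symmetric]
        by (auto simp: lborel.emeasure_pair_measure_Times)
    qed
  qed auto
  then have "4 * frac_interaction s (polarization e t E) (- polarization e t E) < 4 * frac_interaction s E (- E)"
    by (simp add: four_point_sum_integral)
  then show ?thesis
    by (metis mult_left_mono not_le zero_le)
qed

end

section \<open>Minimizers of the energy\<close>

text \<open>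
  The capillarity energy without bulk term, with the constants \<open>a = k1\<close> and \<open>b = \<sigma> k2\<close>. With
  values in the nonnegative extended reals, finiteness has to be assumed only where terms are
  cancelled.
\<close>

definition frac_energy ::
    "real \<Rightarrow> real \<Rightarrow> real \<Rightarrow> real \<Rightarrow> 'a::euclidean_space set \<Rightarrow> 'a set \<Rightarrow> ennreal" where
  "frac_energy a s1 b s2 \<Omega> E =
     ennreal a * frac_interaction s1 E (- E \<inter> \<Omega>) + ennreal b * frac_interaction s2 E (- \<Omega>)"

text \<open>
  Finiteness of the energy is part of the notion, since otherwise minimality carries no
  information.
\<close>

definition frac_minimizer ::
    "real \<Rightarrow> real \<Rightarrow> real \<Rightarrow> real \<Rightarrow> 'a::euclidean_space set \<Rightarrow> 'a set \<Rightarrow> bool" where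
  "frac_minimizer a s1 b s2 \<Omega> E \<longleftrightarrow>
     E \<in> sets borel \<and> E \<subseteq> \<Omega> \<and> emeasure lborel E < emeasure lborel \<Omega> \<and>
     frac_energy a s1 b s2 \<Omega> E < \<infinity> \<and>
     (\<forall>F\<in>sets borel. F \<subseteq> \<Omega> \<longrightarrow> emeasure lborel F = emeasure lborel E \<longrightarrow>
        frac_energy a s1 b s2 \<Omega> E \<le> frac_energy a s1 b s2 \<Omega> F)"

lemma capillarity_energy_frac_kernel:
  assumes [measurable]: "F \<in> sets borel" "\<Omega> \<in> sets borel" and "0 \<le> k1" "0 \<le> k2" "0 \<le> \<sigma>"
  shows "capillarity_energy (frac_kernel k1 s1) (frac_kernel k2 s2) \<sigma> (\<lambda>_. 0) \<Omega> F =
    enn2ereal (frac_energy k1 s1 (\<sigma> * k2) s2 \<Omega> F)"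
proof -
  have "interaction (frac_kernel k1 s1) F (- F \<inter> \<Omega>) = ennreal k1 * frac_interaction s1 F (- F \<inter> \<Omega>)"
    using assms by (intro interaction_frac_kernel) auto
  moreover have "interaction (frac_kernel k2 s2) F (- \<Omega>) = ennreal k2 * frac_interaction s2 F (- \<Omega>)"
    using assms by (intro interaction_frac_kernel) auto
  moreover have "ereal \<sigma> = enn2ereal (ennreal \<sigma>)"
    using \<open>0 \<le> \<sigma>\<close> by (simp add: enn2ereal_ennreal)
  ultimately show ?thesis
    using assms by (simp add: capillarity_energy_def frac_energy_def plus_ennreal.rep_eq times_ennreal.rep_eq
        ennreal_mult enn2ereal_ennreal mult.assoc set_lebesgue_integral_def zero_ereal_def[symmetric])
qed

text \<open>
  The concentric ball of the prescribed volume is a competitor of finite energy.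
\<close>

lemma frac_energy_ball_finite:
  fixes r :: real
  assumes "0 < s1" "s1 < 1" "0 < s2" "s2 < 1" "0 < r" "r \<le> 1"
  shows "frac_energy a s1 b s2 (ball 0 1) (ball (0::'a::euclidean_space) r) < \<infinity>"
proof -
  have fin: "frac_interaction s (ball (0::'a) r) Y < \<infinity>" if s: "0 < s" "s < 1" "Y \<subseteq> - ball 0 r" for s Y
  proof -
    obtain C where "frac_interaction s (ball (0::'a) r) (- ball 0 r) \<le> ennreal (C * r powr (real DIM('a) - s))"
      using frac_perimeter_ball_le[OF s(1,2)] \<open>0 < r\<close> by metis
    then show ?thesis
      using frac_interaction_mono[OF order_refl s(3), of s "ball 0 r"]
      using ennreal_less_top by (metis infinity_ennreal_def order.strict_trans1)
  qed
  show ?thesis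
    using fin[of s1 "- ball 0 r \<inter> ball 0 1"] fin[of s2 "- ball 0 1"] assms
    by (simp add: frac_energy_def ennreal_mult_less_top subset_ball)
qed

text \<open>
  A Borel subset of full measure of \<open>E\<close>, enlarged by the open part \<open>V \<inter> \<Omega>\<close> that \<open>E\<close> is known to
  contain, has the energy and the volume of \<open>E\<close>.
\<close>

lemma volume_constrained_minimizer_imp_frac_minimizer:
  fixes E :: "'a::euclidean_space set"
  assumes min: "volume_constrained_minimizer (frac_kernel k1 s1) (frac_kernel k2 s2) \<sigma> (\<lambda>_. 0) (ball 0 1) E"
    and s: "0 < s1" "s1 < 1" "0 < s2" "s2 < 1" and k: "0 < k1" "0 < k2" "0 < \<sigma>"
    and V: "open V" "V \<inter> ball 0 1 \<subseteq> E"
  obtains E' where "frac_minimizer k1 s1 (\<sigma> * k2) s2 (ball 0 1) E'" "V \<inter> ball 0 1 \<subseteq> E'"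
proof
  let ?\<Omega> = "ball (0::'a) 1"
  let ?C = "capillarity_energy (frac_kernel k1 s1) (frac_kernel k2 s2) \<sigma> (\<lambda>_. 0) ?\<Omega>"
  let ?e = "frac_energy k1 s1 (\<sigma> * k2) s2 ?\<Omega>"
  have E: "E \<in> sets lebesgue" "E \<subseteq> ?\<Omega>" "0 < emeasure lebesgue E" "emeasure lebesgue E < emeasure lebesgue ?\<Omega>"
    and least: "\<And>F. F \<in> sets lebesgue \<Longrightarrow> F \<subseteq> ?\<Omega> \<Longrightarrow> emeasure lebesgue F = emeasure lebesgue E \<Longrightarrow> ?C E \<le> ?C F"
    using min by (auto simp: volume_constrained_minimizer_def)
  define E' where "E' = main_part lborel E \<union> (V \<inter> ?\<Omega>)"
  have [measurable]: "E' \<in> sets borel"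
    using E(1) V(1) main_part_sets[of E lborel] by (simp add: E'_def)
  have main: "main_part lborel E \<subseteq> E"
    using main_part_null_part_Un[OF E(1)] by blast
  then have E': "E' \<subseteq> ?\<Omega>" using E(2) by (auto simp: E'_def)
  have AE: "AE x in lborel. x \<in> E \<longleftrightarrow> x \<in> E'"
    using AE_in_main_part[OF E(1)] by eventually_elim (use V(2) main in \<open>auto simp: E'_def\<close>)
  have vol: "emeasure lebesgue E = emeasure lborel E'"
  proof -
    have "emeasure lebesgue E = emeasure lborel (main_part lborel E)"
      using E(1) by (simp add: emeasure_completion)
    also have "\<dots> = emeasure lborel E'"
      using AE AE_in_main_part[OF E(1)] main_part_sets[OF E(1)]
      by (intro emeasure_eq_AE) auto
    finally show ?thesis .
  qed
  have CE: "?C E = ?C E'"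
  proof -
    have "interaction (frac_kernel k1 s1) E (- E \<inter> ?\<Omega>) = interaction (frac_kernel k1 s1) E' (- E' \<inter> ?\<Omega>)"
      using AE by (intro interaction_cong_AE) (auto elim: eventually_mono)
    moreover have "interaction (frac_kernel k2 s2) E (- ?\<Omega>) = interaction (frac_kernel k2 s2) E' (- ?\<Omega>)"
      using AE by (intro interaction_cong_AE) auto
    ultimately show ?thesis
      by (simp add: capillarity_energy_def set_lebesgue_integral_def)
  qed
  have C_borel: "?C F = enn2ereal (?e F)" if "F \<in> sets borel" for F
    using that k by (intro capillarity_energy_frac_kernel) auto
  have e_le: "?e E' \<le> ?e F" if F: "F \<in> sets borel" "F \<subseteq> ?\<Omega>" "emeasure lborel F = emeasure lborel E'" for F
  proof -
    have "?C E \<le> ?C F"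
      using F vol by (intro least) (auto simp: emeasure_completion)
    then show ?thesis
      by (simp add: CE C_borel F(1) less_eq_ennreal.rep_eq)
  qed
  have "?e E' < \<infinity>"
  proof -
    define \<omega> where "\<omega> = unit_ball_vol (real DIM('a))"
    have "0 < \<omega>" by (simp add: \<omega>_def)
    have eball: "emeasure lborel (ball (0::'a) r) = ennreal (\<omega> * r ^ DIM('a))" if "0 \<le> r" for r
      using that by (simp add: emeasure_ball \<omega>_def)
    have less: "0 < emeasure lborel E'" "emeasure lborel E' < ennreal \<omega>"
      using E(3,4) vol eball[of 1] by (auto simp: emeasure_completion)
    define v where "v = measure lborel E'"
    have v: "emeasure lborel E' = ennreal v"
      unfolding v_def using less(2) by (intro emeasure_eq_ennreal_measure) auto
    have "0 < v" "v < \<omega>" using less \<open>0 < \<omega>\<close> unfolding v by (simp_all add: ennreal_less_iff ennreal_less_zero_iff v_def)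
    define r where "r = root DIM('a) (v / \<omega>)"
    have r: "r ^ DIM('a) = v / \<omega>" "0 < r"
      using \<open>0 < v\<close> \<open>0 < \<omega>\<close> by (simp_all add: r_def)
    have "r \<le> 1"
    proof (rule ccontr)
      assume "\<not> r \<le> 1"
      then have "1 \<le> r ^ DIM('a)" by (intro one_le_power) simp
      then show False using r(1) \<open>v < \<omega>\<close> \<open>0 < \<omega>\<close> by simp
    qed
    have "?e E' \<le> ?e (ball 0 r)"
      using r \<open>r \<le> 1\<close> \<open>0 < \<omega>\<close> by (intro e_le) (auto simp: v eball subset_ball)
    also have "\<dots> < \<infinity>"
      using s r(2) \<open>r \<le> 1\<close> by (intro frac_energy_ball_finite)
    finally show ?thesis .
  qed
  moreover have "emeasure lborel E' < emeasure lborel ?\<Omega>"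
    using E(4) vol by (simp add: emeasure_completion)
  ultimately show "frac_minimizer k1 s1 (\<sigma> * k2) s2 ?\<Omega> E'"
    using E' e_le by (auto simp: frac_minimizer_def)
  show "V \<inter> ?\<Omega> \<subseteq> E'" by (auto simp: E'_def)
qed

section \<open>Contact with the wall when \<open>s1 < s2\<close>\<close>

text \<open>
  Cutting out \<open>D\<close> creates at most the interface of \<open>D\<close>, and adding \<open>D'\<close> at most that of \<open>D'\<close>,
  whatever the shape of \<open>E\<close>. What remains of the energy of \<open>E\<close> is finite and cancels.
\<close>

lemma frac_minimizer_surgery:
  fixes E :: "'a::euclidean_space set"
  assumes min: "frac_minimizer a s1 b s2 \<Omega> E"
    and [measurable]: "\<Omega> \<in> sets borel" "D \<in> sets borel" "D' \<in> sets borel" and "D' \<subseteq> \<Omega>"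
    and vol: "emeasure lborel ((E - D) \<union> D') = emeasure lborel E"
  shows "ennreal b * frac_interaction s2 (E \<inter> D) (- \<Omega>) \<le>
    ennreal a * (frac_interaction s1 D (- D) + frac_interaction s1 D' (- D')) +
    ennreal b * frac_interaction s2 D' (- \<Omega>)"
proof -
  define F where "F = (E - D) \<union> D'"
  have [measurable]: "E \<in> sets borel" and E: "E \<subseteq> \<Omega>" and fin: "frac_energy a s1 b s2 \<Omega> E < \<infinity>"
    using min by (auto simp: frac_minimizer_def)
  have [measurable]: "F \<in> sets borel" by (simp add: F_def)
  have le: "frac_energy a s1 b s2 \<Omega> E \<le> frac_energy a s1 b s2 \<Omega> F"
  proof -
    have "F \<subseteq> \<Omega>" using \<open>D' \<subseteq> \<Omega>\<close> E by (auto simp: F_def)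
    moreover have "emeasure lborel F = emeasure lborel E" using vol by (simp add: F_def)
    ultimately show ?thesis using min unfolding frac_minimizer_def by simp
  qed
  have "frac_interaction s1 F (- F \<inter> \<Omega>) \<le>
      frac_interaction s1 (E - D) (- F \<inter> \<Omega>) + frac_interaction s1 D' (- F \<inter> \<Omega>)"
    unfolding F_def by (rule frac_interaction_Un_left) auto
  also have "\<dots> \<le> frac_interaction s1 (E - D) ((- E \<inter> \<Omega>) \<union> D) + frac_interaction s1 D' (- D')"
    by (intro add_mono frac_interaction_mono) (auto simp: F_def)
  also have "frac_interaction s1 (E - D) ((- E \<inter> \<Omega>) \<union> D) \<le>
      frac_interaction s1 (E - D) (- E \<inter> \<Omega>) + frac_interaction s1 (E - D) D"
    by (rule frac_interaction_Un_right) auto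
  also have "\<dots> \<le> frac_interaction s1 E (- E \<inter> \<Omega>) + frac_interaction s1 (- D) D"
    by (intro add_mono frac_interaction_mono) auto
  also have "frac_interaction s1 (- D) D = frac_interaction s1 D (- D)"
    by (rule frac_interaction_commute) auto
  finally have 1: "frac_interaction s1 F (- F \<inter> \<Omega>) \<le> frac_interaction s1 E (- E \<inter> \<Omega>) +
      frac_interaction s1 D (- D) + frac_interaction s1 D' (- D')"
    by (simp add: add_right_mono)
  have 2: "frac_interaction s2 F (- \<Omega>) \<le> frac_interaction s2 (E - D) (- \<Omega>) + frac_interaction s2 D' (- \<Omega>)"
    unfolding F_def by (rule frac_interaction_Un_left) auto
  have "frac_interaction s2 ((E - D) \<union> (E \<inter> D)) (- \<Omega>) =
      frac_interaction s2 (E - D) (- \<Omega>) + frac_interaction s2 (E \<inter> D) (- \<Omega>)"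
    by (rule frac_interaction_Un_left) auto
  moreover have "(E - D) \<union> (E \<inter> D) = E" by auto
  ultimately have 3: "frac_interaction s2 E (- \<Omega>) =
      frac_interaction s2 (E - D) (- \<Omega>) + frac_interaction s2 (E \<inter> D) (- \<Omega>)"
    by simp
  define c where "c = ennreal a * frac_interaction s1 E (- E \<inter> \<Omega>) + ennreal b * frac_interaction s2 (E - D) (- \<Omega>)"
  have "frac_energy a s1 b s2 \<Omega> E = c + ennreal b * frac_interaction s2 (E \<inter> D) (- \<Omega>)"
    by (simp add: frac_energy_def c_def 3 distrib_left add.assoc)
  moreover from this fin have "c \<noteq> \<infinity>" by auto
  moreover have "frac_energy a s1 b s2 \<Omega> F \<le>
      ennreal a * (frac_interaction s1 E (- E \<inter> \<Omega>) + frac_interaction s1 D (- D) + frac_interaction s1 D' (- D')) +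
      ennreal b * (frac_interaction s2 (E - D) (- \<Omega>) + frac_interaction s2 D' (- \<Omega>))"
    unfolding frac_energy_def by (intro add_mono mult_left_mono 1 2) auto
  moreover have "\<dots> = c + (ennreal a * (frac_interaction s1 D (- D) + frac_interaction s1 D' (- D')) +
      ennreal b * frac_interaction s2 D' (- \<Omega>))"
    by (simp only: c_def distrib_left ac_simps)
  ultimately have "c + ennreal b * frac_interaction s2 (E \<inter> D) (- \<Omega>) \<le>
      c + (ennreal a * (frac_interaction s1 D (- D) + frac_interaction s1 D' (- D')) +
      ennreal b * frac_interaction s2 D' (- \<Omega>))"
    using le by order
  then show ?thesis
    using \<open>c \<noteq> \<infinity>\<close> by (subst (asm) ennreal_add_left_cancel_le) auto
qed

lemma frac_interaction_ge:
  fixes X Y :: "'a::euclidean_space set"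
  assumes [measurable]: "X \<in> sets borel" "Y \<in> sets borel" and "0 < s" "X \<inter> Y = {}"
    and near: "\<And>x y. x \<in> X \<Longrightarrow> y \<in> Y \<Longrightarrow> dist x y \<le> \<delta>"
  shows "ennreal (\<delta> powr - (real DIM('a) + s)) * (emeasure lborel X * emeasure lborel Y) \<le> frac_interaction s X Y"
proof -
  have "ennreal (\<delta> powr - (real DIM('a) + s)) * (emeasure lborel X * emeasure lborel Y) =
      ennreal (\<delta> powr - (real DIM('a) + s)) * emeasure (lborel \<Otimes>\<^sub>M lborel) (X \<times> Y)"
    by (simp add: lborel.emeasure_pair_measure_Times)
  also have "\<dots> = (\<integral>\<^sup>+z. ennreal (\<delta> powr - (real DIM('a) + s)) * indicator (X \<times> Y) z \<partial>(lborel \<Otimes>\<^sub>M lborel))"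
    by (rule nn_integral_cmult_indicator[symmetric]) simp
  also have "\<dots> \<le> frac_interaction s X Y"
    unfolding frac_interaction_pair[OF assms(1,2)]
  proof (rule nn_integral_mono)
    fix z :: "'a \<times> 'a"
    show "ennreal (\<delta> powr - (real DIM('a) + s)) * indicator (X \<times> Y) z \<le>
      indicator X (fst z) * indicator Y (snd z) * ennreal (norm (fst z - snd z) powr - (real DIM('a) + s))"
    proof (cases "fst z \<in> X \<and> snd z \<in> Y")
      case True
      then have "\<delta> powr - (real DIM('a) + s) \<le> norm (fst z - snd z) powr - (real DIM('a) + s)"
        using near[of "fst z" "snd z"] assms(3,4) by (intro powr_mono2') (auto simp: dist_norm)
      then show ?thesis
        using True by (simp add: indicator_def mem_Times_iff ennreal_leI)
    qed (auto simp: indicator_def mem_Times_iff)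
  qed
  finally show ?thesis .
qed

text \<open>
  On either side of the sphere the ball around \<open>p\<close> contains a ball of half its radius; all
  points of these two balls are within \<open>2 r\<close> of each other.
\<close>

lemma frac_interaction_sphere_cap_ge:
  fixes p :: "'a::euclidean_space"
  assumes "0 < s" "norm p = 1" "0 < r" "r \<le> 1"
  shows "ennreal (2 powr - (real DIM('a) + s) * (unit_ball_vol (real DIM('a)) / 2 ^ DIM('a))\<^sup>2 *
      r powr (real DIM('a) - s)) \<le> frac_interaction s (ball p r \<inter> ball 0 1) (- ball 0 1)"
proof -
  define n where "n = DIM('a)"
  define \<omega> where "\<omega> = unit_ball_vol (real n)"
  have "0 < \<omega>" by (simp add: \<omega>_def)
  define X where "X = ball ((1 - r / 2) *\<^sub>R p) (r / 2)"
  define Y where "Y = ball ((1 + r / 2) *\<^sub>R p) (r / 2)"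
  have sh: "dist p (c *\<^sub>R p) = \<bar>1 - c\<bar>" for c
  proof -
    have "p - c *\<^sub>R p = (1 - c) *\<^sub>R p" by (simp add: scaleR_diff_left)
    then show ?thesis using assms(2) by (simp add: dist_norm)
  qed
  have X: "X \<subseteq> ball p r \<inter> ball 0 1"
  proof
    fix x assume "x \<in> X"
    then have "dist ((1 - r / 2) *\<^sub>R p) x < r / 2" by (simp add: X_def)
    moreover have "norm ((1 - r / 2) *\<^sub>R p) = 1 - r / 2" using assms by simp
    ultimately show "x \<in> ball p r \<inter> ball 0 1"
      using dist_triangle[of p x "(1 - r / 2) *\<^sub>R p"] sh[of "1 - r / 2"] assms
        dist_triangle[of 0 x "(1 - r / 2) *\<^sub>R p"] by simp
  qed
  have Y: "Y \<subseteq> ball p r - ball 0 1"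
  proof
    fix x assume "x \<in> Y"
    then have "dist ((1 + r / 2) *\<^sub>R p) x < r / 2" by (simp add: Y_def)
    moreover have "norm ((1 + r / 2) *\<^sub>R p) = 1 + r / 2" using assms by simp
    ultimately show "x \<in> ball p r - ball 0 1"
      using dist_triangle[of p x "(1 + r / 2) *\<^sub>R p"] sh[of "1 + r / 2"] assms
        dist_triangle[of 0 "(1 + r / 2) *\<^sub>R p" x] by (simp add: dist_commute)
  qed
  have "ennreal ((2 * r) powr - (real n + s)) * (emeasure lborel X * emeasure lborel Y) \<le> frac_interaction s X Y"
    unfolding n_def
  proof (rule frac_interaction_ge)
    fix x y assume "x \<in> X" "y \<in> Y"
    then have "dist p x < r" "dist p y < r" using X Y by auto
    then show "dist x y \<le> 2 * r" using dist_triangle3[of x y p] by simp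
  qed (use X Y \<open>0 < s\<close> in \<open>auto simp: X_def Y_def\<close>)
  also have "\<dots> \<le> frac_interaction s (ball p r \<inter> ball 0 1) (- ball 0 1)"
    using X Y by (intro frac_interaction_mono) auto
  finally have "ennreal ((2 * r) powr - (real n + s)) * (emeasure lborel X * emeasure lborel Y) \<le>
      frac_interaction s (ball p r \<inter> ball 0 1) (- ball 0 1)" .
  moreover have "emeasure lborel X = ennreal (\<omega> * (r / 2) ^ n)" "emeasure lborel Y = ennreal (\<omega> * (r / 2) ^ n)"
    using assms by (simp_all add: X_def Y_def emeasure_ball \<omega>_def n_def)
  moreover have "ennreal ((2 * r) powr - (real n + s)) * (ennreal (\<omega> * (r / 2) ^ n) * ennreal (\<omega> * (r / 2) ^ n)) =
      ennreal ((2 * r) powr - (real n + s) * (\<omega> * (r / 2) ^ n)\<^sup>2)"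
    using \<open>0 < \<omega>\<close> \<open>0 < r\<close> by (simp add: ennreal_mult[symmetric] power2_eq_square)
  moreover have "(2 * r) powr - (real n + s) * (\<omega> * (r / 2) ^ n)\<^sup>2 =
      2 powr - (real n + s) * (\<omega> / 2 ^ n)\<^sup>2 * r powr (real n - s)"
  proof -
    have "(\<omega> * (r / 2) ^ n)\<^sup>2 = (\<omega> / 2 ^ n)\<^sup>2 * r powr (2 * real n)"
      using \<open>0 < r\<close> powr_realpow[of r "2 * n"] by (simp add: power_divide power_mult_distrib power_mult[symmetric] mult.commute)
    moreover have "(2 * r) powr - (real n + s) = 2 powr - (real n + s) * r powr - (real n + s)"
      using \<open>0 < r\<close> by (simp add: powr_mult)
    moreover have "r powr - (real n + s) * r powr (2 * real n) = r powr (real n - s)"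
      by (simp add: powr_add[symmetric])
    ultimately show ?thesis
      by (simp add: mult_ac)
  qed
  ultimately show ?thesis
    by (simp add: n_def \<omega>_def)
qed

text \<open>
  Averaging: the integral over \<open>z\<close> of the volume of \<open>ball z \<rho> \<inter> M\<close> is \<open>\<omega> \<rho>^n\<close> times that of \<open>M\<close>,
  and only centres in a ball of volume less than \<open>\<omega>\<close> contribute.
\<close>

lemma exists_ball_large_intersection:
  fixes M :: "'a::euclidean_space set"
  assumes [measurable]: "M \<in> sets borel" and M: "M \<subseteq> ball 0 R" "0 < emeasure lborel M"
    and \<rho>: "0 < \<rho>" "0 < R" "R + \<rho> < 1"
  obtains z where "norm z < R + \<rho>" "emeasure lborel M * ennreal (\<rho> ^ DIM('a)) \<le> emeasure lborel (ball z \<rho> \<inter> M)"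
proof (rule ccontr)
  assume contr: "\<not> thesis"
  define n where "n = DIM('a)"
  define \<omega> where "\<omega> = unit_ball_vol (real n)"
  have "0 < \<omega>" "0 < n" by (simp_all add: \<omega>_def n_def)
  have finM: "emeasure lborel M < \<infinity>"
    using emeasure_mono[OF M(1), of lborel] emeasure_lborel_ball_finite[of 0 R]
    by (auto intro: order.strict_trans1)
  have inner: "(\<integral>\<^sup>+z. indicator M x * indicator (ball x \<rho>) z \<partial>lborel) = ennreal (\<omega> * \<rho> ^ n) * indicator M x" for x
    using \<rho>(1) by (subst nn_integral_cmult_indicator) (auto simp: emeasure_ball \<omega>_def n_def mult.commute)
  have "emeasure lborel M * ennreal (\<omega> * \<rho> ^ n) = (\<integral>\<^sup>+x. \<integral>\<^sup>+z. indicator M x * indicator (ball x \<rho>) z \<partial>lborel \<partial>lborel)"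
    unfolding inner by (subst nn_integral_cmult_indicator) (simp_all add: mult.commute)
  also have "\<dots> = (\<integral>\<^sup>+z. \<integral>\<^sup>+x. indicator M x * indicator (ball x \<rho>) z \<partial>lborel \<partial>lborel)"
  proof (rule lborel_pair.Fubini')
    have "(\<lambda>(z, x). indicator M x * indicator {..<\<rho>} (dist x z) :: ennreal) \<in> borel_measurable (lborel \<Otimes>\<^sub>M lborel)"
      by measurable
    then show "(\<lambda>(z, x). indicator M x * indicator (ball x \<rho>) z :: ennreal) \<in> borel_measurable (lborel \<Otimes>\<^sub>M lborel)"
      by (simp add: indicator_def)
  qed
  also have "\<dots> = (\<integral>\<^sup>+z. emeasure lborel (ball z \<rho> \<inter> M) \<partial>lborel)"
  proof (rule nn_integral_cong)
    fix z
    have "(\<integral>\<^sup>+x. indicator M x * indicator (ball x \<rho>) z \<partial>lborel) = (\<integral>\<^sup>+x. indicator (ball z \<rho> \<inter> M) x \<partial>lborel)"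
      by (intro nn_integral_cong) (auto simp: indicator_def dist_commute)
    then show "(\<integral>\<^sup>+x. indicator M x * indicator (ball x \<rho>) z \<partial>lborel) = emeasure lborel (ball z \<rho> \<inter> M)"
      by simp
  qed
  also have "\<dots> \<le> (\<integral>\<^sup>+z. emeasure lborel M * ennreal (\<rho> ^ n) * indicator (ball (0::'a) (R + \<rho>)) z \<partial>lborel)"
  proof (rule nn_integral_mono)
    fix z :: 'a
    show "emeasure lborel (ball z \<rho> \<inter> M) \<le> emeasure lborel M * ennreal (\<rho> ^ n) * indicator (ball 0 (R + \<rho>)) z"
    proof (cases "norm z < R + \<rho>")
      case True
      then have "\<not> emeasure lborel M * ennreal (\<rho> ^ n) \<le> emeasure lborel (ball z \<rho> \<inter> M)"
        using contr that[of z] by (auto simp: n_def)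
      then show ?thesis using True by (simp add: not_le less_imp_le)
    next
      case False
      have "ball z \<rho> \<inter> M = {}"
      proof (rule ccontr)
        assume "ball z \<rho> \<inter> M \<noteq> {}"
        then obtain x where "dist z x < \<rho>" "x \<in> M" by auto
        moreover from this have "norm x < R" using M(1) by auto
        ultimately show False using False dist_triangle[of z 0 x] by simp
      qed
      then show ?thesis by simp
    qed
  qed
  also have "\<dots> = emeasure lborel M * ennreal (\<rho> ^ n) * ennreal (\<omega> * (R + \<rho>) ^ n)"
    using \<rho> by (subst nn_integral_cmult_indicator) (simp_all add: emeasure_ball \<omega>_def n_def)
  also have "\<dots> = emeasure lborel M * ennreal (\<rho> ^ n * (\<omega> * (R + \<rho>) ^ n))"
    using \<rho> \<open>0 < \<omega>\<close> by (subst ennreal_mult) (auto simp: mult.assoc)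
  finally have "ennreal (\<omega> * \<rho> ^ n) \<le> ennreal (\<rho> ^ n * (\<omega> * (R + \<rho>) ^ n))"
    using M(2) finM by (subst (asm) ennreal_mult_le_mult_iff) auto
  then have "\<omega> * \<rho> ^ n \<le> \<rho> ^ n * (\<omega> * (R + \<rho>) ^ n)"
    using \<rho> \<open>0 < \<omega>\<close> by (subst (asm) ennreal_le_iff) auto
  then have "1 \<le> (R + \<rho>) ^ n"
    using \<rho>(1) \<open>0 < \<omega>\<close> by simp
  moreover have "(R + \<rho>) ^ n < 1"
    using \<rho> \<open>0 < n\<close> by (intro power_less_one_iff[THEN iffD2]) auto
  ultimately show False by simp
qed

text \<open>
  The volume of \<open>ball z r - E\<close> grows no faster in \<open>r\<close> than that of the ball, hence depends
  continuously on \<open>r\<close>, and the intermediate value theorem applies.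
\<close>

lemma exists_ball_prescribed_Diff_measure:
  fixes z :: "'a::euclidean_space"
  assumes [measurable]: "E \<in> sets borel" and "0 \<le> \<rho>" "0 \<le> V" "V \<le> measure lborel (ball z \<rho> - E)"
  obtains r where "0 \<le> r" "r \<le> \<rho>" "measure lborel (ball z r - E) = V"
proof -
  define \<phi> where "\<phi> r = measure lborel (ball z r - E)" for r
  define g where "g r = measure lborel (ball z r)" for r
  have fin: "emeasure lborel (ball z r - S) < \<infinity>" for r and S :: "'a set"
    using emeasure_mono[of "ball z r - S" "ball z r" lborel] emeasure_lborel_ball_finite[of z r]
    by (auto intro: order.strict_trans1)
  have step: "\<bar>\<phi> r' - \<phi> r\<bar> \<le> \<bar>g r' - g r\<bar>" if "r \<le> r'" for r r'
  proof -
    have sub: "ball z r \<subseteq> ball z r'" using that by auto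
    have "\<phi> r' - \<phi> r = measure lborel ((ball z r' - E) - (ball z r - E))"
      unfolding \<phi>_def using sub fin[of r' E] by (subst measure_Diff) auto
    also have "\<dots> \<le> measure lborel (ball z r' - ball z r)"
      using fin[of r' "ball z r"] by (intro measure_mono_fmeasurable) (auto simp: fmeasurable_def)
    also have "\<dots> = g r' - g r"
      unfolding g_def using sub fin[of r' "{}"] by (subst measure_Diff) auto
    finally have "\<phi> r' - \<phi> r \<le> g r' - g r" .
    moreover have "\<phi> r \<le> \<phi> r'"
      unfolding \<phi>_def using sub fin[of r' E] by (intro measure_mono_fmeasurable) (auto simp: fmeasurable_def)
    ultimately show ?thesis by simp
  qed
  then have step: "\<bar>\<phi> r' - \<phi> r\<bar> \<le> \<bar>g r' - g r\<bar>" for r r'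
    by (metis abs_minus_commute linear)
  have "continuous_on {0..\<rho>} g"
  proof (rule continuous_on_eq)
    show "continuous_on {0..\<rho>} (\<lambda>r. unit_ball_vol (real DIM('a)) * r ^ DIM('a))"
      by (intro continuous_intros)
  qed (auto simp: g_def content_ball)
  then have "continuous_on {0..\<rho>} \<phi>"
    unfolding continuous_on_iff dist_real_def using step by (meson order.strict_trans1)
  moreover have "\<phi> 0 \<le> V" using \<open>0 \<le> V\<close> by (simp add: \<phi>_def)
  ultimately obtain r where "0 \<le> r" "r \<le> \<rho>" "\<phi> r = V"
    using IVT'[of \<phi> 0 V \<rho>] assms(2,4) by (auto simp: \<phi>_def)
  then show ?thesis using that by (simp add: \<phi>_def)
qed

text \<open>
  With \<open>D = ball p r\<close> and a ball \<open>D'\<close> of radius \<open>t \<le> \<Lambda> r\<close> at distance \<open>d\<close> from the complement of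
  \<open>\<Omega>\<close>, the surgery inequality becomes \<open>b c r^(n-s2) \<le> C' r^(n-s1)\<close> with constants independent of
  \<open>r\<close>, which fails for small \<open>r\<close>.
\<close>

lemma frac_minimizer_not_containing_cap:
  fixes E :: "'a::euclidean_space set"
  assumes min: "frac_minimizer a s1 b s2 (ball 0 1) E"
    and s: "0 < s1" "s1 < s2" "s2 < 1" and ab: "0 \<le> a" "0 < b"
    and p: "norm p = 1" "0 < \<epsilon>"
  shows "\<not> ball p \<epsilon> \<inter> ball 0 1 \<subseteq> E"
proof
  assume cap: "ball p \<epsilon> \<inter> ball 0 1 \<subseteq> E"
  define n where "n = DIM('a)"
  define \<omega> where "\<omega> = unit_ball_vol (real n)"
  have "0 < \<omega>" "0 < n" by (simp_all add: \<omega>_def n_def)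
  let ?\<Omega> = "ball (0::'a) 1"
  have [measurable]: "E \<in> sets borel" and E: "E \<subseteq> ?\<Omega>" "emeasure lborel E < emeasure lborel ?\<Omega>"
    using min by (auto simp: frac_minimizer_def)
  have finball: "emeasure lborel S < \<infinity>" if "S \<subseteq> ball z \<rho>" for S and z :: 'a and \<rho>
    using emeasure_mono[OF that, of lborel] emeasure_lborel_ball_finite[of z \<rho>]
    by (auto intro: order.strict_trans1)
  have eball: "emeasure lborel (ball z \<rho>) = ennreal (\<omega> * \<rho> ^ n)" if "0 \<le> \<rho>" for z :: 'a and \<rho>
    using that by (simp add: emeasure_ball \<omega>_def n_def)

  \<comment> \<open>Room for \<open>D'\<close>: by continuity of the measure \<open>E\<close> misses a set of positive measure at a positive
    distance from the sphere.\<close>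
  obtain R where R: "0 < R" "R < 1" "0 < emeasure lborel (ball 0 R - E)"
  proof (rule ccontr)
    assume contr: "\<not> thesis"
    have "?\<Omega> - E = (\<Union>k. ball 0 (1 - 1 / real (k + 2)) - E)"
    proof -
      have "\<exists>k. norm x < 1 - 1 / real (k + 2)" if "norm x < 1" for x :: 'a
      proof -
        obtain k where k: "inverse (real (Suc k)) < 1 - norm x"
          using reals_Archimedean[of "1 - norm x"] \<open>norm x < 1\<close> by (metis diff_gt_0_iff_gt)
        have "1 / real (k + 2) \<le> inverse (real (Suc k))"
          by (simp add: field_simps)
        then show ?thesis using k by (intro exI[of _ k]) simp
      qed
      moreover have "norm x < 1" if "norm x < 1 - 1 / real (k + 2)" for x :: 'a and k
        using that by (rule order.strict_trans2) simp
      ultimately show ?thesis by auto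
    qed
    moreover have "emeasure lborel (\<Union>k. ball 0 (1 - 1 / real (k + 2)) - E) = 0"
    proof (rule emeasure_UN_eq_0)
      fix k :: nat
      show "emeasure lborel (ball 0 (1 - 1 / real (k + 2)) - E) = 0"
        using contr that[of "1 - 1 / real (k + 2)"] by (auto simp: zero_less_iff_neq_zero)
    qed auto
    ultimately have "emeasure lborel (?\<Omega> - E) = 0" by simp
    moreover have "emeasure lborel ?\<Omega> = emeasure lborel E + emeasure lborel (?\<Omega> - E)"
      using E(1) by (subst plus_emeasure) (auto simp: Un_absorb1)
    ultimately show False using E(2) by simp
  qed
  define M where "M = ball 0 R - E"
  have [measurable]: "M \<in> sets borel" by (simp add: M_def)
  define m where "m = measure lborel M"
  have finM: "emeasure lborel M < \<infinity>" using finball[of M 0 R] by (auto simp: M_def)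
  have m: "emeasure lborel M = ennreal m"
    unfolding m_def using finM by (intro emeasure_eq_ennreal_measure) auto
  have "0 < m" using R(3) m by (simp add: M_def[symmetric] ennreal_less_zero_iff)
  define d where "d = (1 - R) / 3"
  have "0 < d" using R by (simp add: d_def)
  \<comment> \<open>With this factor, averaging over radius \<open>\<Lambda> r\<close> finds room for at least the volume \<open>\<omega> r^n\<close> of all of \<open>D\<close>.\<close>
  define \<Lambda> where "\<Lambda> = max 1 (\<omega> / m)"
  have "1 \<le> \<Lambda>" "\<omega> \<le> m * \<Lambda> ^ n"
  proof -
    show "1 \<le> \<Lambda>" by (simp add: \<Lambda>_def)
    then have "\<Lambda> \<le> \<Lambda> ^ n" using \<open>0 < n\<close> by (intro self_le_power) auto
    moreover have "\<omega> \<le> m * \<Lambda>" using \<open>0 < m\<close> by (simp add: \<Lambda>_def max_def field_simps)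
    ultimately show "\<omega> \<le> m * \<Lambda> ^ n" using \<open>0 < m\<close> by (meson mult_left_mono less_imp_le order_trans)
  qed
  obtain C where C: "0 < C" "\<And>(c::'a) r. 0 < r \<Longrightarrow>
      frac_interaction s1 (ball c r) (- ball c r) \<le> ennreal (C * r powr (real n - s1))"
    using frac_perimeter_ball_le[of s1] s unfolding n_def by (metis order.strict_trans)
  define C2 where "C2 = (real n + s2) * \<omega> * (d powr - s2 / s2)"
  have "0 < C2" using s \<open>0 < \<omega>\<close> \<open>0 < d\<close> by (simp add: C2_def)
  define c where "c = 2 powr - (real n + s2) * (\<omega> / 2 ^ n)\<^sup>2"
  have "0 < c" using \<open>0 < \<omega>\<close> by (simp add: c_def)
  define C' where "C' = a * (C + C * \<Lambda> powr (real n - s1)) + b * (C2 * (\<omega> * \<Lambda> ^ n)) + 1"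
  have "0 < C'" using ab C(1) \<open>0 < C2\<close> \<open>0 < \<omega>\<close> \<open>1 \<le> \<Lambda>\<close> by (simp add: C'_def add_nonneg_pos)

  have key: "b * c * r powr (real n - s2) \<le> C' * r powr (real n - s1)"
    if r: "0 < r" "r \<le> 1" "r \<le> \<epsilon>" "\<Lambda> * r \<le> d" for r
  proof -
    define D where "D = ball p r"
    define \<rho> where "\<rho> = \<Lambda> * r"
    define V where "V = measure lborel (D \<inter> ?\<Omega>)"
    have "1 * r \<le> \<Lambda> * r" using \<open>1 \<le> \<Lambda>\<close> r(1) by (intro mult_right_mono) auto
    then have "r \<le> d" using r(4) by simp
    have "0 < \<rho>" using r(1) \<open>1 \<le> \<Lambda>\<close> by (simp add: \<rho>_def)
    have [measurable]: "D \<in> sets borel" by (simp add: D_def)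
    have "E \<inter> D = D \<inter> ?\<Omega>" using cap r(3) E(1) by (auto simp: D_def)
    have eV: "emeasure lborel (D \<inter> ?\<Omega>) = ennreal V"
      unfolding V_def using finball[of "D \<inter> ?\<Omega>" p r] by (intro emeasure_eq_ennreal_measure) (auto simp: D_def)
    have "ennreal V \<le> ennreal (\<omega> * r ^ n)"
      unfolding eV[symmetric] eball[OF less_imp_le[OF r(1)], of p, symmetric]
      by (intro emeasure_mono) (auto simp: D_def)
    then have "V \<le> \<omega> * r ^ n" using \<open>0 < \<omega>\<close> r(1) by (simp add: ennreal_le_iff)
    also have "\<dots> \<le> (m * \<Lambda> ^ n) * r ^ n"
      using \<open>\<omega> \<le> m * \<Lambda> ^ n\<close> r(1) by (intro mult_right_mono) auto
    finally have V_le: "V \<le> m * \<rho> ^ n" by (simp add: \<rho>_def power_mult_distrib mult_ac)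
    obtain z where z: "norm z < R + \<rho>" "emeasure lborel M * ennreal (\<rho> ^ n) \<le> emeasure lborel (ball z \<rho> \<inter> M)"
    proof -
      have "M \<subseteq> ball 0 R" by (auto simp: M_def)
      moreover have "0 < emeasure lborel M" using R(3) by (simp add: M_def)
      moreover have "R + \<rho> < 1" using r(4) \<open>0 < d\<close> by (simp add: \<rho>_def d_def field_simps)
      ultimately show ?thesis
        using exists_ball_large_intersection[of M R \<rho>] that \<open>0 < \<rho>\<close> R(1) by (auto simp: n_def)
    qed
    have "ennreal V \<le> ennreal (m * \<rho> ^ n)" using V_le by (rule ennreal_leI)
    also have "\<dots> \<le> emeasure lborel (ball z \<rho> \<inter> M)"
      using z(2) \<open>0 < m\<close> \<open>0 < \<rho>\<close> by (simp add: m ennreal_mult)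
    also have "\<dots> \<le> emeasure lborel (ball z \<rho> - E)"
      by (intro emeasure_mono) (auto simp: M_def)
    also have "\<dots> = ennreal (measure lborel (ball z \<rho> - E))"
      using finball[of "ball z \<rho> - E" z \<rho>] by (intro emeasure_eq_ennreal_measure) auto
    finally have "V \<le> measure lborel (ball z \<rho> - E)" by (simp add: ennreal_le_iff)
    then obtain t where t: "0 \<le> t" "t \<le> \<rho>" "measure lborel (ball z t - E) = V"
      using exists_ball_prescribed_Diff_measure[of E \<rho> V z] \<open>0 < \<rho>\<close> by (auto simp: V_def)
    define D' where "D' = ball z t"
    have [measurable]: "D' \<in> sets borel" by (simp add: D'_def)
    have D'_in: "norm x < 1 - d" if "x \<in> D'" for x
      using that z(1) t(2) r(4) dist_triangle[of 0 x z] by (simp add: D'_def \<rho>_def d_def field_simps)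
    have "D' \<subseteq> ?\<Omega>" using D'_in \<open>0 < d\<close> by force
    have "D \<inter> D' = {}"
    proof (rule ccontr)
      assume "D \<inter> D' \<noteq> {}"
      then obtain x where "dist p x < r" "x \<in> D'" by (auto simp: D_def)
      then show False
        using D'_in[of x] \<open>r \<le> d\<close> p(1) dist_triangle[of p 0 x] by simp
    qed
    have vol: "emeasure lborel ((E - D) \<union> D') = emeasure lborel E"
    proof -
      have "(E - D) \<union> D' = (E - D) \<union> (D' - E)" using \<open>D \<inter> D' = {}\<close> by auto
      then have "emeasure lborel ((E - D) \<union> D') = emeasure lborel (E - D) + emeasure lborel (D' - E)"
        by (subst plus_emeasure) auto
      also have "emeasure lborel (D' - E) = ennreal V"
        using finball[of "D' - E" z t] t(3)
        by (subst emeasure_eq_ennreal_measure) (auto simp: D'_def)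
      also have "\<dots> = emeasure lborel (E \<inter> D)"
        using eV \<open>E \<inter> D = D \<inter> ?\<Omega>\<close> by simp
      also have "emeasure lborel (E - D) + emeasure lborel (E \<inter> D) = emeasure lborel ((E - D) \<union> (E \<inter> D))"
        by (rule plus_emeasure) auto
      also have "(E - D) \<union> (E \<inter> D) = E" by auto
      finally show ?thesis .
    qed
    have PD: "frac_interaction s1 D (- D) \<le> ennreal (C * r powr (real n - s1))"
      unfolding D_def by (rule C(2)[OF r(1)])
    have PD': "frac_interaction s1 D' (- D') \<le> ennreal (C * \<Lambda> powr (real n - s1) * r powr (real n - s1))"
    proof (cases "t = 0")
      case True
      then show ?thesis by (simp add: D'_def frac_interaction_def)
    next
      case False
      then have "frac_interaction s1 D' (- D') \<le> ennreal (C * t powr (real n - s1))"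
        unfolding D'_def using t(1) by (intro C(2)) simp
      also have "\<dots> \<le> ennreal (C * \<rho> powr (real n - s1))"
        using t C(1) s \<open>0 < n\<close> by (intro ennreal_leI mult_left_mono powr_mono2) auto
      also have "\<rho> powr (real n - s1) = \<Lambda> powr (real n - s1) * r powr (real n - s1)"
        using r(1) \<open>1 \<le> \<Lambda>\<close> by (simp add: \<rho>_def powr_mult)
      finally show ?thesis by (simp add: mult.assoc)
    qed
    have ID': "frac_interaction s2 D' (- ?\<Omega>) \<le> ennreal (C2 * (\<omega> * \<Lambda> ^ n) * r powr (real n - s1))"
    proof -
      have "frac_interaction s2 D' (- ?\<Omega>) \<le> ennreal C2 * emeasure lborel D'"
        unfolding C2_def n_def \<omega>_def
      proof (rule frac_interaction_separated_le)
        fix x y assume "x \<in> D'" "y \<in> - ?\<Omega>"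
        then show "d \<le> dist x y"
          using D'_in[of x] dist_triangle[of 0 y x] by simp
      qed (use s \<open>0 < d\<close> in auto)
      also have "emeasure lborel D' = ennreal (\<omega> * t ^ n)"
        unfolding D'_def by (rule eball[OF t(1)])
      also have "\<dots> \<le> ennreal (\<omega> * \<Lambda> ^ n * r powr (real n - s1))"
      proof (rule ennreal_leI)
        have "t ^ n \<le> \<Lambda> ^ n * r ^ n"
          using power_mono[OF t(2,1), of n] by (simp add: \<rho>_def power_mult_distrib)
        also have "r ^ n = r powr real n" using r(1) by (simp add: powr_realpow)
        also have "\<dots> \<le> r powr (real n - s1)"
          using r s by (intro powr_mono') auto
        finally show "\<omega> * t ^ n \<le> \<omega> * \<Lambda> ^ n * r powr (real n - s1)"
          using \<open>0 < \<omega>\<close> \<open>1 \<le> \<Lambda>\<close> by (simp add: mult.assoc mult_left_mono)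
      qed
      finally have "frac_interaction s2 D' (- ?\<Omega>) \<le> ennreal C2 * ennreal (\<omega> * \<Lambda> ^ n * r powr (real n - s1))"
        by (simp add: mult_left_mono)
      then show ?thesis
        using \<open>0 < C2\<close> \<open>0 < \<omega>\<close> \<open>1 \<le> \<Lambda>\<close> by (simp add: ennreal_mult[symmetric] mult.assoc)
    qed
    have "ennreal (b * (c * r powr (real n - s2))) \<le> ennreal b * frac_interaction s2 (E \<inter> D) (- ?\<Omega>)"
      unfolding \<open>E \<inter> D = D \<inter> ?\<Omega>\<close> unfolding D_def
      using frac_interaction_sphere_cap_ge[of s2 p r] s p r ab \<open>0 < c\<close>
      by (subst ennreal_mult) (auto simp: c_def n_def \<omega>_def intro!: mult_left_mono)
    also have "\<dots> \<le> ennreal a * (frac_interaction s1 D (- D) + frac_interaction s1 D' (- D')) +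
        ennreal b * frac_interaction s2 D' (- ?\<Omega>)"
      by (rule frac_minimizer_surgery[OF min]) (use vol \<open>D' \<subseteq> ?\<Omega>\<close> in auto)
    also have "\<dots> \<le> ennreal a * (ennreal (C * r powr (real n - s1)) +
          ennreal (C * \<Lambda> powr (real n - s1) * r powr (real n - s1))) +
        ennreal b * ennreal (C2 * (\<omega> * \<Lambda> ^ n) * r powr (real n - s1))"
      by (intro add_mono mult_left_mono PD PD' ID') auto
    also have "\<dots> = ennreal (a * (C * r powr (real n - s1) + C * \<Lambda> powr (real n - s1) * r powr (real n - s1)) +
        b * (C2 * (\<omega> * \<Lambda> ^ n) * r powr (real n - s1)))"
      using ab C(1) \<open>0 < C2\<close> \<open>0 < \<omega>\<close> \<open>1 \<le> \<Lambda>\<close>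
      by (simp flip: ennreal_plus ennreal_mult)
    also have "\<dots> \<le> ennreal (C' * r powr (real n - s1))"
      by (intro ennreal_leI) (simp add: C'_def algebra_simps)
    finally show ?thesis
      using \<open>0 < C'\<close> by (subst (asm) ennreal_le_iff) (auto simp: mult.assoc)
  qed

  \<comment> \<open>At \<open>r = x\<close> one has \<open>C' r^(s2-s1) = b c / 2\<close>, and smaller radii only make this smaller.\<close>
  define x where "x = (b * c / (2 * C')) powr (1 / (s2 - s1))"
  define r where "r = min (min 1 \<epsilon>) (min (d / \<Lambda>) x)"
  have "0 < b * c / (2 * C')" using ab \<open>0 < c\<close> \<open>0 < C'\<close> by simp
  then have "0 < x" unfolding x_def by (metis powr_gt_zero less_irrefl)
  then have "0 < r" using p(2) \<open>0 < d\<close> \<open>1 \<le> \<Lambda>\<close> by (simp add: r_def)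
  have "\<Lambda> * r \<le> \<Lambda> * (d / \<Lambda>)"
    using \<open>1 \<le> \<Lambda>\<close> by (intro mult_left_mono) (auto simp: r_def)
  then have "\<Lambda> * r \<le> d" using \<open>1 \<le> \<Lambda>\<close> by simp
  then have "b * c * r powr (real n - s2) \<le> C' * r powr (real n - s1)"
    using \<open>0 < r\<close> by (intro key) (auto simp: r_def)
  also have "r powr (real n - s1) = r powr (s2 - s1) * r powr (real n - s2)"
    by (simp add: powr_add[symmetric])
  finally have "b * c \<le> C' * r powr (s2 - s1)"
    using \<open>0 < r\<close> by (simp add: mult.assoc[symmetric])
  also have "r powr (s2 - s1) \<le> x powr (s2 - s1)"
    using \<open>0 < r\<close> s by (intro powr_mono2) (auto simp: r_def)
  also have "x powr (s2 - s1) = b * c / (2 * C')"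
    using ab \<open>0 < c\<close> \<open>0 < C'\<close> s by (simp add: x_def powr_powr abs_mult)
  finally have "b * c \<le> b * c / 2"
    using \<open>0 < C'\<close> by (simp add: mult_left_mono)
  moreover have "0 < b * c" using ab \<open>0 < c\<close> by simp
  ultimately show False by simp
qed

section \<open>Equal exponents\<close>

text \<open>
  Near \<open>x\<close>, the set \<open>E\<close> fills \<open>\<Omega>\<close> up to a null set. The centre \<open>x\<close> may lie on the boundary of
  \<open>\<Omega>\<close>, and \<open>negligible\<close> rather than a measure spares measurability side conditions.
\<close>

definition full_at :: "'a::euclidean_space set \<Rightarrow> 'a set \<Rightarrow> 'a \<Rightarrow> bool" where
  "full_at \<Omega> E x \<longleftrightarrow> (\<exists>\<rho>>0. negligible (ball x \<rho> \<inter> \<Omega> - E))"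

text \<open>
  The complement of \<open>E\<close> consists of \<open>\<Omega> - E\<close> and \<open>- \<Omega>\<close>; for equal exponents the part \<open>a\<close> of the
  wall coefficient completes the perimeter of \<open>E\<close>.
\<close>

lemma frac_energy_same_exponent:
  assumes [measurable]: "E \<in> sets borel" "\<Omega> \<in> sets borel" and "E \<subseteq> \<Omega>" "0 \<le> a" "a \<le> b"
  shows "frac_energy a s b s \<Omega> E =
    ennreal a * frac_interaction s E (- E) + ennreal (b - a) * frac_interaction s E (- \<Omega>)"
proof -
  have "- E = (- E \<inter> \<Omega>) \<union> - \<Omega>" using \<open>E \<subseteq> \<Omega>\<close> by auto
  moreover have "frac_interaction s E ((- E \<inter> \<Omega>) \<union> - \<Omega>) =
      frac_interaction s E (- E \<inter> \<Omega>) + frac_interaction s E (- \<Omega>)"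
    by (rule frac_interaction_Un_right) auto
  ultimately have split: "frac_interaction s E (- E) = frac_interaction s E (- E \<inter> \<Omega>) + frac_interaction s E (- \<Omega>)"
    by simp
  have "ennreal b = ennreal a + ennreal (b - a)"
    using assms by (simp flip: ennreal_plus)
  then show ?thesis
    by (simp only: frac_energy_def split distrib_left distrib_right add.assoc)
qed

lemma polarization_ball:
  assumes "norm e = 1" "0 \<le> t"
  shows "polarization e t (ball 0 r) = ball 0 r"
proof -
  have *: "(norm (reflection e t z))\<^sup>2 = (norm z)\<^sup>2 + 4 * - t * (z \<bullet> e - t)" for z
    using norm_diff_reflection_sqr[OF assms(1), of 0 t z] by simp
  have 1: "norm z \<le> norm (reflection e t z)" if "z \<bullet> e < t" for z
  proof (rule power2_le_imp_le)
    have "0 \<le> t * (t - z \<bullet> e)" using that \<open>0 \<le> t\<close> by simp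
    then show "(norm z)\<^sup>2 \<le> (norm (reflection e t z))\<^sup>2" unfolding * by (simp add: algebra_simps)
  qed simp
  have 2: "norm (reflection e t z) \<le> norm z" if "\<not> z \<bullet> e < t" for z
  proof (rule power2_le_imp_le)
    have "0 \<le> t * (z \<bullet> e - t)" using that \<open>0 \<le> t\<close> by simp
    then show "(norm (reflection e t z))\<^sup>2 \<le> (norm z)\<^sup>2" unfolding * by (simp add: algebra_simps)
  qed simp
  have "z \<in> polarization e t (ball 0 r) \<longleftrightarrow> z \<in> ball 0 r" for z
    using 1[of z] 2[of z] by (cases "z \<bullet> e < t") (auto simp: polarization_def)
  then show ?thesis by blast
qed

lemma polarization_mono: "E \<subseteq> G \<Longrightarrow> polarization e t E \<subseteq> polarization e t G"
  by (auto simp: polarization_def)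

text \<open>
  The polarized set is an admissible competitor, and it would be strictly better if both sets
  had positive measure.
\<close>

lemma frac_minimizer_polarization:
  fixes E :: "'a::euclidean_space set"
  assumes min: "frac_minimizer a s b s (ball 0 1) E" and "0 < s" "0 < a" "a \<le> b"
    and e: "norm e = 1" and t: "0 \<le> t"
  shows "emeasure lborel {x \<in> E. x \<bullet> e < t \<and> reflection e t x \<notin> E} = 0 \<or>
    emeasure lborel {x \<in> - E. x \<bullet> e < t \<and> reflection e t x \<in> E} = 0"
proof (rule ccontr)
  assume contr: "\<not> ?thesis"
  let ?\<Omega> = "ball (0::'a) 1" and ?P = "polarization e t E"
  have [measurable]: "E \<in> sets borel" and "E \<subseteq> ?\<Omega>" and fin: "frac_energy a s b s ?\<Omega> E < \<infinity>"
    using min by (auto simp: frac_minimizer_def)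
  have [measurable]: "?P \<in> sets borel"
    by (rule polarization_measurable[OF e]) simp
  have "?P \<subseteq> ?\<Omega>"
    using polarization_mono[OF \<open>E \<subseteq> ?\<Omega>\<close>] polarization_ball[OF e t] by metis
  have fin': "ennreal a * frac_interaction s E (- E) < \<infinity>" "ennreal (b - a) * frac_interaction s E (- ?\<Omega>) < \<infinity>"
    using fin \<open>0 < a\<close> \<open>a \<le> b\<close> by (auto simp: frac_energy_same_exponent[OF _ _ \<open>E \<subseteq> ?\<Omega>\<close>])
  have "frac_interaction s E (- E) < \<infinity>"
    using fin'(1) \<open>0 < a\<close> by (auto simp: ennreal_mult_less_top)
  then have less: "frac_interaction s ?P (- ?P) < frac_interaction s E (- E)"
    using contr by (intro frac_interaction_polarization_less e \<open>0 < s\<close>) (auto simp: zero_less_iff_neq_zero)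
  have "frac_energy a s b s ?\<Omega> E \<le> frac_energy a s b s ?\<Omega> ?P"
    using min \<open>?P \<subseteq> ?\<Omega>\<close> emeasure_polarization[OF e, of E t] by (auto simp: frac_minimizer_def)
  then have "ennreal a * frac_interaction s E (- E) + ennreal (b - a) * frac_interaction s E (- ?\<Omega>) \<le>
      ennreal a * frac_interaction s ?P (- ?P) + ennreal (b - a) * frac_interaction s ?P (- ?\<Omega>)"
    using \<open>0 < a\<close> \<open>a \<le> b\<close>
    by (simp add: frac_energy_same_exponent[OF _ _ \<open>E \<subseteq> ?\<Omega>\<close>] frac_energy_same_exponent[OF _ _ \<open>?P \<subseteq> ?\<Omega>\<close>])
  also have "frac_interaction s ?P (- ?\<Omega>) \<le> frac_interaction s E (- ?\<Omega>)"
    using frac_interaction_polarization_le[OF e, of E ?\<Omega> s t] \<open>0 < s\<close> \<open>E \<subseteq> ?\<Omega>\<close>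
    by (simp add: polarization_ball[OF e t])
  finally have "ennreal a * frac_interaction s E (- E) + ennreal (b - a) * frac_interaction s E (- ?\<Omega>) \<le>
      ennreal a * frac_interaction s ?P (- ?P) + ennreal (b - a) * frac_interaction s E (- ?\<Omega>)"
    by (simp add: add_left_mono mult_left_mono)
  then have "ennreal a * frac_interaction s E (- E) \<le> ennreal a * frac_interaction s ?P (- ?P)"
    using fin'(2) ennreal_add_left_cancel_le[of "ennreal (b - a) * frac_interaction s E (- ?\<Omega>)"]
    by (metis add.commute less_irrefl infinity_ennreal_def)
  then have "frac_interaction s E (- E) \<le> frac_interaction s ?P (- ?P)"
    using \<open>0 < a\<close> by (subst (asm) ennreal_mult_le_mult_iff) auto
  then show False
    using less by simp
qed

lemma negligible_iff_emeasure_lborel: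
  "S \<in> sets borel \<Longrightarrow> negligible S \<longleftrightarrow> emeasure lborel S = 0"
  by (simp add: negligible_iff_null_sets null_sets_completion_iff null_sets_def)

lemma open_full_at: "open {x. full_at \<Omega> E x}"
proof (rule openI)
  fix x assume "x \<in> {x. full_at \<Omega> E x}"
  then obtain \<rho> where \<rho>: "0 < \<rho>" "negligible (ball x \<rho> \<inter> \<Omega> - E)"
    by (auto simp: full_at_def)
  have "full_at \<Omega> E y" if y: "y \<in> ball x \<rho>" for y
  proof -
    obtain \<delta> where "0 < \<delta>" "ball y \<delta> \<subseteq> ball x \<rho>"
      using openE[OF open_ball y] by blast
    then show ?thesis
      unfolding full_at_def using negligible_subset[OF \<rho>(2), of "ball y \<delta> \<inter> \<Omega> - E"] by blast
  qed
  then show "\<exists>e>0. ball x e \<subseteq> {x. full_at \<Omega> E x}"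
    using \<rho>(1) by blast
qed

text \<open>
  Negligibility is a local property, by the Lindelof property.
\<close>

lemma negligible_open_Diff:
  assumes "open \<Omega>" "open V" "\<And>x. x \<in> V \<inter> \<Omega> \<Longrightarrow> full_at \<Omega> E x"
  shows "negligible (V \<inter> \<Omega> - E)"
proof (subst locally_negligible_alt, rule ballI)
  fix x assume x: "x \<in> V \<inter> \<Omega> - E"
  then obtain \<rho> where \<rho>: "0 < \<rho>" "negligible (ball x \<rho> \<inter> \<Omega> - E)"
    using assms(3)[of x] by (auto simp: full_at_def)
  have "openin (top_of_set (V \<inter> \<Omega> - E)) ((V \<inter> \<Omega> - E) \<inter> ball x \<rho>)"
    by (rule openin_open_Int) simp
  moreover have "negligible ((V \<inter> \<Omega> - E) \<inter> ball x \<rho>)"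
    by (rule negligible_subset[OF \<rho>(2)]) auto
  ultimately show "\<exists>U. openin (top_of_set (V \<inter> \<Omega> - E)) U \<and> x \<in> U \<and> negligible U"
    using x \<rho>(1) by (metis IntI centre_in_ball)
qed

lemma negligible_reflection_vimage:
  assumes "norm e = 1" "N \<in> sets borel" "negligible N"
  shows "negligible (reflection e t -` N)"
proof -
  have "emeasure lborel (reflection e t -` N) = emeasure (distr lborel borel (reflection e t)) N"
    by (subst emeasure_distr) (use reflection_measurable[OF assms(1)] assms(2) in simp_all)
  also have "\<dots> = emeasure lborel N"
    by (simp only: lborel_distr_reflection[OF assms(1)])
  also have "\<dots> = 0"
    using assms(3) by (simp only: negligible_iff_emeasure_lborel[OF assms(2)])
  finally have "emeasure lborel (reflection e t -` N) = 0" .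
  moreover have "reflection e t -` N \<in> sets borel"
    using measurable_sets[OF reflection_measurable[OF assms(1), of t] assms(2)]
    by (simp only: space_borel Int_UNIV_right)
  ultimately show ?thesis
    by (simp only: negligible_iff_emeasure_lborel)
qed

text \<open>
  Reflect in the bisecting hyperplane of \<open>x\<close> and \<open>y\<close>. As \<open>|x| < |y|\<close>, the origin lies on the
  side of \<open>x\<close>, and so does \<open>q\<close> by the second inequality. Near \<open>q\<close> the set \<open>E\<close> contains points
  whose mirror images lie outside \<open>\<Omega>\<close>, because the mirror image of \<open>q\<close> has norm greater than
  \<open>1\<close>. So the first alternative of \<open>frac_minimizer_polarization\<close> is excluded, and by the second
  one almost all mirror images of the points of \<open>E\<close> near \<open>y\<close> belong to \<open>E\<close>.
\<close>

lemma full_at_bisector: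
  fixes E :: "'a::euclidean_space set"
  assumes min: "frac_minimizer a s b s (ball 0 1) E" and "0 < s" "0 < a" "a \<le> b"
    and q: "norm q = 1" "full_at (ball 0 1) E q"
    and y: "norm y < 1" "full_at (ball 0 1) E y"
    and x: "norm x < norm y" "dist x q < dist y q"
  shows "full_at (ball 0 1) E x"
proof (rule ccontr)
  assume notfull: "\<not> full_at (ball 0 1) E x"
  let ?\<Omega> = "ball (0::'a) 1"
  have [measurable]: "E \<in> sets borel" and "E \<subseteq> ?\<Omega>"
    using min by (auto simp: frac_minimizer_def)
  define d where "d = norm (y - x)"
  define e where "e = (1 / d) *\<^sub>R (y - x)"
  define t where "t = ((norm y)\<^sup>2 - (norm x)\<^sup>2) / (2 * d)"
  define R where "R = reflection e t"
  \<comment> \<open>The signed distance to the hyperplane; it is negative on the side of \<open>x\<close> and of the origin.\<close>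
  define l where "l z = z \<bullet> e - t" for z
  have "0 < d" using x by (auto simp: d_def)
  have e: "norm e = 1" using \<open>0 < d\<close> by (simp add: e_def d_def)
  have "0 < t" using x(1) \<open>0 < d\<close> by (simp add: t_def power_strict_mono)
  have "l x = - d / 2"
  proof -
    have "2 * d * (x \<bullet> e) = 2 * (x \<bullet> y) - 2 * (norm x)\<^sup>2"
      using \<open>0 < d\<close> by (simp add: e_def inner_diff_right power2_norm_eq_inner algebra_simps)
    moreover have "2 * d * t = (norm y)\<^sup>2 - (norm x)\<^sup>2"
      using \<open>0 < d\<close> by (simp add: t_def)
    moreover have "d * d = (norm y)\<^sup>2 - 2 * (x \<bullet> y) + (norm x)\<^sup>2"
      unfolding d_def power2_norm_eq_inner power2_eq_square[symmetric]
      by (simp add: inner_diff_left inner_diff_right inner_commute)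
    ultimately have "2 * d * l x = 2 * d * (- d / 2)"
      by (simp add: l_def algebra_simps)
    then show ?thesis using \<open>0 < d\<close> by (simp only: mult_cancel_left) simp
  qed
  have Rx: "R x = y"
  proof -
    have "R x = x + d *\<^sub>R e"
      using \<open>l x = - d / 2\<close> by (simp add: R_def reflection_def l_def)
    then show ?thesis using \<open>0 < d\<close> by (simp add: e_def)
  qed
  have "l q < 0"
  proof -
    have "(norm (q - y))\<^sup>2 = (norm (q - x))\<^sup>2 + 4 * l q * l x"
      using norm_diff_reflection_sqr[OF e, of q t x] Rx by (simp add: R_def l_def)
    moreover have "(norm (q - x))\<^sup>2 < (norm (q - y))\<^sup>2"
      using x(2) by (intro power_strict_mono) (auto simp: dist_norm norm_minus_commute)
    ultimately have "0 < - l q * d"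
      using \<open>l x = - d / 2\<close> by (simp add: mult.commute)
    then show ?thesis using \<open>0 < d\<close> by (simp add: zero_less_mult_iff mult_less_0_iff)
  qed
  have "1 < norm (R q)"
  proof -
    have "(norm (R q))\<^sup>2 = 1 - 4 * t * l q"
      using norm_diff_reflection_sqr[OF e, of 0 t q] q(1) by (simp add: R_def l_def)
    moreover have "t * l q < 0"
      using \<open>0 < t\<close> \<open>l q < 0\<close> by (simp add: mult_less_0_iff)
    ultimately have "1\<^sup>2 < (norm (R q))\<^sup>2" by simp
    then show ?thesis by (rule power2_less_imp_less) simp
  qed
  have cont [continuous_intros]: "continuous_on UNIV R" "continuous_on UNIV l"
    unfolding R_def reflection_def l_def by (intro continuous_intros)+
  have openH: "open {z. l z < 0}"
    by (intro open_Collect_less continuous_intros cont)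
  have A: "emeasure lborel {z \<in> E. z \<bullet> e < t \<and> R z \<notin> E} \<noteq> 0"
  proof
    assume 0: "emeasure lborel {z \<in> E. z \<bullet> e < t \<and> R z \<notin> E} = 0"
    obtain \<rho> where \<rho>: "0 < \<rho>" "negligible (ball q \<rho> \<inter> ?\<Omega> - E)"
      using q(2) by (auto simp: full_at_def)
    define W where "W = ball q \<rho> \<inter> {z. l z < 0} \<inter> {z. 1 < norm (R z)}"
    have "open W"
      unfolding W_def by (intro open_Int openH open_ball open_Collect_less continuous_intros cont)
    moreover have "q \<in> W"
      using \<rho>(1) \<open>l q < 0\<close> \<open>1 < norm (R q)\<close> by (simp add: W_def)
    moreover have "q \<in> closure ?\<Omega>"
      using q(1) by simp
    ultimately have "W \<inter> ?\<Omega> \<noteq> {}"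
      using open_Int_closure_eq_empty[of W ?\<Omega>] by auto
    moreover have "open (W \<inter> ?\<Omega>)" using \<open>open W\<close> by auto
    ultimately have "\<not> negligible (W \<inter> ?\<Omega>)"
      by (simp add: open_not_negligible)
    moreover have "negligible {z \<in> E. z \<bullet> e < t \<and> R z \<notin> E}"
      using 0 reflection_measurable[OF e, of t] by (subst negligible_iff_emeasure_lborel) (auto simp: R_def)
    then have "negligible ((ball q \<rho> \<inter> ?\<Omega> - E) \<union> {z \<in> E. z \<bullet> e < t \<and> R z \<notin> E})"
      using \<rho>(2) by (rule negligible_Un[rotated])
    then have "negligible (W \<inter> ?\<Omega>)"
      by (rule negligible_subset) (use \<open>E \<subseteq> ?\<Omega>\<close> in \<open>force simp: W_def l_def\<close>)
    ultimately show False by simp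
  qed
  have B: "emeasure lborel {z \<in> - E. z \<bullet> e < t \<and> R z \<in> E} \<noteq> 0"
  proof
    assume 0: "emeasure lborel {z \<in> - E. z \<bullet> e < t \<and> R z \<in> E} = 0"
    obtain \<rho> where \<rho>: "0 < \<rho>" "negligible (ball y \<rho> \<inter> ?\<Omega> - E)"
      using y(2) by (auto simp: full_at_def)
    define W where "W = {z. l z < 0} \<inter> {z. dist y (R z) < \<rho>} \<inter> {z. norm (R z) < 1}"
    have "open W"
      unfolding W_def by (intro open_Int openH open_Collect_less continuous_intros cont)
    moreover have "x \<in> W"
      using \<rho>(1) Rx y(1) \<open>l x = - d / 2\<close> \<open>0 < d\<close> by (simp add: W_def)
    ultimately obtain \<delta> where \<delta>: "0 < \<delta>" "ball x \<delta> \<subseteq> W"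
      by (auto simp: open_contains_ball)
    have "negligible {z \<in> - E. z \<bullet> e < t \<and> R z \<in> E}"
      using 0 reflection_measurable[OF e, of t] by (subst negligible_iff_emeasure_lborel) (auto simp: R_def)
    moreover have "negligible (R -` (ball y \<rho> \<inter> ?\<Omega> - E))"
      unfolding R_def using \<rho>(2) by (intro negligible_reflection_vimage e) auto
    ultimately have "negligible ({z \<in> - E. z \<bullet> e < t \<and> R z \<in> E} \<union> R -` (ball y \<rho> \<inter> ?\<Omega> - E))"
      by (rule negligible_Un)
    then have "negligible (ball x \<delta> \<inter> ?\<Omega> - E)"
      by (rule negligible_subset) (use \<delta>(2) in \<open>force simp: W_def l_def\<close>)
    then show False
      using notfull \<delta>(1) by (auto simp: full_at_def)
  qed
  show False
    using frac_minimizer_polarization[OF min assms(2-4) e less_imp_le[OF \<open>0 < t\<close>]] A B by (simp add: R_def)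
qed

text \<open>
  Points of \<open>\<Omega>\<close> sufficiently close to \<open>q'\<close> can serve as \<open>y\<close> in \<open>full_at_bisector\<close>.
\<close>

lemma full_at_sphere_ball:
  fixes E :: "'a::euclidean_space set"
  assumes min: "frac_minimizer a s b s (ball 0 1) E" and "0 < s" "0 < a" "a \<le> b"
    and q: "norm q = 1" "full_at (ball 0 1) E q"
    and q': "norm q' = 1" "full_at (ball 0 1) E q'"
  shows "negligible (ball q (dist q' q) \<inter> ball 0 1 - E)"
proof (rule negligible_open_Diff)
  fix x assume x: "x \<in> ball q (dist q' q) \<inter> ball 0 1"
  define W where "W = {y. full_at (ball 0 1) E y} \<inter> {y. norm x < norm y} \<inter> {y. dist x q < dist y q}"
  have "open W"
    unfolding W_def by (intro open_Int open_full_at open_Collect_less continuous_intros)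
  moreover have "q' \<in> W"
    using x q' by (simp add: W_def dist_commute)
  moreover have "q' \<in> closure (ball 0 1)"
    using q'(1) by simp
  ultimately have "W \<inter> ball 0 1 \<noteq> {}"
    using open_Int_closure_eq_empty[of W "ball (0::'a) 1"] by auto
  then obtain y where "y \<in> W" "norm y < 1" by auto
  then show "full_at (ball 0 1) E x"
    using full_at_bisector[OF assms(1-6), of y x] by (auto simp: W_def)
qed auto

text \<open>
  The set \<open>\<Gamma>\<close> of full points of the sphere is closed because a limit point \<open>z \<noteq> p\<close> is eventually
  closer to the approximating points \<open>q\<close> than \<open>p\<close> is, so that \<open>full_at_sphere_ball\<close> applies to
  \<open>q\<close> and \<open>p\<close>. Once \<open>p\<close> and \<open>- p\<close> are both full, the ball of radius \<open>2\<close> around \<open>p\<close> contains all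
  of \<open>\<Omega>\<close>.
\<close>

lemma frac_minimizer_not_full_at_sphere:
  fixes E :: "'a::euclidean_space set"
  assumes min: "frac_minimizer a s b s (ball 0 1) E" and "0 < s" "0 < a" "a \<le> b"
    and "2 \<le> DIM('a)" and p: "norm p = 1" 
  shows "\<not> full_at (ball 0 1) E p"
proof
  assume full: "full_at (ball 0 1) E p"
  let ?\<Omega> = "ball (0::'a) 1"
  have [measurable]: "E \<in> sets borel" and E: "E \<subseteq> ?\<Omega>" "emeasure lborel E < emeasure lborel ?\<Omega>"
    using min by (auto simp: frac_minimizer_def)
  define \<Gamma> where "\<Gamma> = sphere 0 1 \<inter> {x. full_at ?\<Omega> E x}"
  have "openin (top_of_set (sphere 0 1)) \<Gamma>"
    unfolding \<Gamma>_def by (intro openin_open_Int open_full_at)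
  moreover have "closedin (top_of_set (sphere 0 1)) \<Gamma>"
    unfolding closedin_limpt
  proof (intro conjI allI impI)
    show "\<Gamma> \<subseteq> sphere 0 1" by (auto simp: \<Gamma>_def)
    fix z assume z: "z islimpt \<Gamma> \<and> z \<in> sphere 0 1"
    show "z \<in> \<Gamma>"
    proof (cases "z = p")
      case True
      then show ?thesis using full p by (simp add: \<Gamma>_def)
    next
      case False
      then obtain q where q: "q \<in> \<Gamma>" "dist q z < dist p z / 2"
        using z unfolding islimpt_approachable by (metis half_gt_zero zero_less_dist_iff)
      then have "z \<in> ball q (dist p q)"
        using dist_triangle[of p z q] by (auto simp: dist_commute)
      then obtain \<delta> where \<delta>: "0 < \<delta>" "ball z \<delta> \<subseteq> ball q (dist p q)"
        using openE[OF open_ball] by blast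
      have "negligible (ball q (dist p q) \<inter> ?\<Omega> - E)"
        using q full p by (intro full_at_sphere_ball[OF assms(1-4)]) (auto simp: \<Gamma>_def)
      then have "negligible (ball z \<delta> \<inter> ?\<Omega> - E)"
        by (rule negligible_subset) (use \<delta>(2) in auto)
      then show ?thesis
        using z \<delta>(1) by (auto simp: \<Gamma>_def full_at_def)
    qed
  qed
  moreover have "connected (sphere (0::'a) 1)"
    using \<open>2 \<le> DIM('a)\<close> by (rule connected_sphere)
  moreover have "p \<in> \<Gamma>" using full p by (simp add: \<Gamma>_def)
  ultimately have "\<Gamma> = sphere 0 1"
    unfolding connected_clopen by blast
  then have "- p \<in> \<Gamma>" using p by simp
  then have "negligible (ball p (dist (- p) p) \<inter> ?\<Omega> - E)"
    using full p by (intro full_at_sphere_ball[OF assms(1-4)]) (auto simp: \<Gamma>_def)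
  moreover have "?\<Omega> \<subseteq> ball p (dist (- p) p)"
  proof
    fix x assume "x \<in> ?\<Omega>"
    moreover have "dist (- p) p = 2"
    proof -
      have "- p - p = - (2 *\<^sub>R p)" by (simp add: scaleR_2)
      then have "dist (- p) p = 2 * norm p" by (simp only: dist_norm norm_minus_cancel norm_scaleR abs_numeral)
      then show ?thesis using p by simp
    qed
    ultimately show "x \<in> ball p (dist (- p) p)"
      using norm_triangle_ineq4[of p x] p by (simp add: dist_norm)
  qed
  ultimately have "negligible (?\<Omega> - E)"
    by (simp add: Int_absorb1)
  then have "emeasure lborel (?\<Omega> - E) = 0"
    by (subst (asm) negligible_iff_emeasure_lborel) auto
  moreover have "emeasure lborel ?\<Omega> = emeasure lborel E + emeasure lborel (?\<Omega> - E)"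
    using E(1) by (subst plus_emeasure) (auto simp: Un_absorb1)
  ultimately show False using E(2) by simp
qed

section \<open>The theorem\<close>

theorem theorem1p7:
  fixes s1 s2 \<sigma> k1 k2 \<epsilon>0 :: real
    and E :: "(real ^ 'n) set"
    and p :: "real ^ 'n"
  assumes "CARD('n) \<ge> 2"
    and "0 < s1" "s1 < 1"
    and "0 < s2" "s2 < 1"
    and "0 < \<sigma>"
    and "0 < k1" "0 < k2"
    and "volume_constrained_minimizer (frac_kernel k1 s1) (frac_kernel k2 s2) \<sigma> (\<lambda>_. 0)
           (ball 0 1) E"
    and "p \<in> frontier (ball 0 1)" "0 < \<epsilon>0"
    and "ball p \<epsilon>0 \<inter> ball 0 1 \<subseteq> E"
    and "Reg s1 (ball 0 1) E \<inter> ball 0 1 \<noteq> {}"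
  shows "s1 > s2 \<or> (s1 = s2 \<and> k1 > \<sigma> * k2)"
proof (rule ccontr)
  assume contr: "\<not> (s1 > s2 \<or> (s1 = s2 \<and> k1 > \<sigma> * k2))"
  have p: "norm p = 1"
    using \<open>p \<in> frontier (ball 0 1)\<close> by simp
  obtain E' where E': "frac_minimizer k1 s1 (\<sigma> * k2) s2 (ball 0 1) E'" "ball p \<epsilon>0 \<inter> ball 0 1 \<subseteq> E'"
    using volume_constrained_minimizer_imp_frac_minimizer[of k1 s1 k2 s2 \<sigma> E "ball p \<epsilon>0"] assms
    by (metis open_ball)
  have "s1 < s2 \<or> (s1 = s2 \<and> k1 \<le> \<sigma> * k2)"
    using contr by linarith
  then show False
  proof (elim disjE conjE)
    assume "s1 < s2"
    then show False
      using frac_minimizer_not_containing_cap[OF E'(1) _ _ _ _ _ p \<open>0 < \<epsilon>0\<close>] E'(2) assms by simp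
  next
    assume "s1 = s2" "k1 \<le> \<sigma> * k2"
    have "ball p \<epsilon>0 \<inter> ball 0 1 - E' = {}"
      using E'(2) by blast
    then have "full_at (ball 0 1) E' p"
      unfolding full_at_def using \<open>0 < \<epsilon>0\<close> by (metis negligible_empty)
    moreover have "2 \<le> DIM(real ^ 'n)"
      using \<open>CARD('n) \<ge> 2\<close> by simp
    ultimately show False
      using frac_minimizer_not_full_at_sphere[of k1 s1 "\<sigma> * k2" E' p] E'(1) p assms
        \<open>s1 = s2\<close> \<open>k1 \<le> \<sigma> * k2\<close> by simp
  qed
qed

end
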